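(* Let $(\Lambda(U,V),d)$ be an elliptic, two-stage minimal model over $\mathbb{Q}$. Assume that $dV\subseteq\Lambda^2U$, and that the two-stage decomposition displays $V$ with maximal dimension. Finally, assume that $U^{\mathrm{odd}}$ and $U^{\mathrm{even}}$ satisfy one of the following hypotheses: (A) for some integer $r$, $U^{\mathrm{odd}}$ is $(2r-1)$-connected and $U^{\mathrm{even}}$ is $(2r+2)$-co-connected; (B) for some integer $s$, $U^{\mathrm{odd}}$ is $(2s+1)$-co-connected and $U^{\mathrm{even}}$ is $(4s-4)$-connected. Then $$\mathrm{rk}_0\big(\Lambda(U,V)\big)\ \leq\ \dim V-\dim U^{\mathrm{even}}.$$
   Context: All vector spaces and algebras are over $\mathbb{Q}$. For a graded vector space $W$ concentrated in degrees $\ge 2$ (all spaces are assumed 1-connected), $\Lambda W$ is the free graded commutative algebra on $W$, and $\Lambda^kW$ is the subspace of elements of word length $k$. A minimal model is a differential graded algebra $(\Lambda W,d)$ with $d$ of degree $+1$ such that $dw$ is a polynomial with no linear term for each $w\in W$. It is elliptic if $W$ and $H(\Lambda W,d)$ are both finite-dimensional. It is two-stage if there is a graded decomposition $W=U\oplus V$ with $dU=0$ and $dV\subseteq\Lambda U$; one then writes $\Lambda(U,V)$, with this decomposition understood. In the elliptic two-stage case $V$ is always concentrated in odd degrees. $U^{\mathrm{odd}}$, $U^{\mathrm{even}}$ are the odd and even degree parts of $U$. The two-stage decomposition displays $V$ with maximal dimension if for every two-stage minimal model $(\Lambda(U',V'),d')$ isomorphic to $(\Lambda(U,V),d)$ one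 has $\dim V'\le\dim V$. A graded vector space $Z$ is $n$-connected if $Z^i=0$ for $i\le n$, and $n$-co-connected if $Z^i=0$ for $i\ge n$. Rational toral rank: $\mathrm{rk}_0(\Lambda W)$ is the largest $n\ge0$ for which there is an extension $\Lambda A_n\to(\Lambda A_n\otimes\Lambda W,D)\to(\Lambda W,d)$ with $A_n=\langle a_1,\dots,a_n\rangle$, each $a_i$ of degree $2$, such that $H(\Lambda A_n\otimes\Lambda W,D)$ is finite-dimensional. Here an extension (K-S extension) means that $D$ is a differential with $D a_i=0$, that $D$ induces $d$ on the quotient $\Lambda W=(\Lambda A_n\otimes\Lambda W)/(A_n)$, and that $W$ has an ordered basis $w_1,w_2,\dots$ with $Dw_i\in\Lambda A_n\otimes\Lambda(w_1,\dots,w_{i-1})$ for each $i$. *)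

theory Defs
  imports "HOL-Library.Multiset" "HOL-Library.Poly_Mapping" "HOL-Library.Extended_Real"
begin

section \<open>Rational vector spaces with a given basis\<close>

definition scl :: "rat \<Rightarrow> ('k \<Rightarrow>\<^sub>0 rat) \<Rightarrow> ('k \<Rightarrow>\<^sub>0 rat)" where
  "scl c p = Poly_Mapping.map ((*) c) p"

lemma lookup_scl: "Poly_Mapping.lookup (scl c p) k = c * Poly_Mapping.lookup p k"
  by (cases "c = 0") (auto simp: scl_def Poly_Mapping.map.rep_eq when_def)

global_interpretation ratvec: vector_space scl
  by unfold_locales (auto intro!: poly_mapping_eqI simp: lookup_scl lookup_add algebra_simps)

text \<open>Order on generators, used only to fix the sign conventions below.\<close>

instantiation sum :: (linorder, linorder) linorder
begin

definition less_eq_sum :: "'a + 'b \<Rightarrow> 'a + 'b \<Rightarrow> bool" where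
  "less_eq_sum x y = (case x of
      Inl a \<Rightarrow> (case y of Inl b \<Rightarrow> a \<le> b | Inr _ \<Rightarrow> True)
    | Inr a \<Rightarrow> (case y of Inl _ \<Rightarrow> False | Inr b \<Rightarrow> a \<le> b))"

definition less_sum :: "'a + 'b \<Rightarrow> 'a + 'b \<Rightarrow> bool" where
  "less_sum x y = (x \<le> y \<and> \<not> y \<le> x)"

instance
  by standard (auto simp: less_eq_sum_def less_sum_def split: sum.splits)

end

section \<open>Free graded commutative algebras\<close>

text \<open>
  A graded vector space is given by a homogeneous basis: a set \<open>X\<close> of generators together with a
  degree function \<open>deg\<close>. A monomial is a multiset of generators in which generators of odd degree
  occur at most once; it stands for the product of its members in increasing order. An element of
  the free graded commutative algebra is a finitely supported rational combination of monomials.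
\<close>

type_synonym 'i galg = "'i multiset \<Rightarrow>\<^sub>0 rat"

definition gen :: "'i \<Rightarrow> 'i galg" where
  "gen i = Poly_Mapping.single {#i#} 1"

definition gone :: "'i galg" where
  "gone = Poly_Mapping.single {#} 1"

definition lin :: "'i set \<Rightarrow> 'i galg set" where
  "lin X = ratvec.span (gen ` X)"

definition Lam :: "('i \<Rightarrow> nat) \<Rightarrow> 'i set \<Rightarrow> 'i galg set" where
  "Lam deg X = {p. \<forall>m \<in> Poly_Mapping.keys p. set_mset m \<subseteq> X \<and> (\<forall>i. odd (deg i) \<longrightarrow> count m i \<le> 1)}"

definition Lam_len :: "('i \<Rightarrow> nat) \<Rightarrow> nat \<Rightarrow> 'i set \<Rightarrow> 'i galg set" where
  "Lam_len deg k X = {p \<in> Lam deg X. \<forall>m \<in> Poly_Mapping.keys p. size m = k}"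

definition homog :: "('i \<Rightarrow> nat) \<Rightarrow> nat \<Rightarrow> 'i galg \<Rightarrow> bool" where
  "homog deg k p \<longleftrightarrow> (\<forall>m \<in> Poly_Mapping.keys p. (\<Sum>i\<in>#m. deg i) = k)"

text \<open>Koszul sign of the permutation that sorts the concatenation of two sorted monomials; it is
  \<open>0\<close> if an odd generator is repeated.\<close>

definition mono_sign :: "('i::linorder \<Rightarrow> nat) \<Rightarrow> 'i multiset \<Rightarrow> 'i multiset \<Rightarrow> rat" where
  "mono_sign deg m n =
    (if \<exists>i. odd (deg i) \<and> i \<in># m \<and> i \<in># n then 0
     else (- 1) ^ card {(i, j). i \<in># m \<and> j \<in># n \<and> odd (deg i) \<and> odd (deg j) \<and> j < i})"

text \<open>This is not the product \<open>*\<close> that \<open>Poly_Mapping\<close> puts on the same type, which ignores signs.\<close>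

definition gmul :: "('i::linorder \<Rightarrow> nat) \<Rightarrow> 'i galg \<Rightarrow> 'i galg \<Rightarrow> 'i galg" where
  "gmul deg p q = (\<Sum>m \<in> Poly_Mapping.keys p. \<Sum>n \<in> Poly_Mapping.keys q.
     Poly_Mapping.single (m + n) (mono_sign deg m n * Poly_Mapping.lookup p m * Poly_Mapping.lookup q n))"

inductive_set subalg :: "('i::linorder \<Rightarrow> nat) \<Rightarrow> 'i galg set \<Rightarrow> 'i galg set"
  for deg :: "'i \<Rightarrow> nat" and S :: "'i galg set" where
  one: "gone \<in> subalg deg S"
| base: "x \<in> S \<Longrightarrow> x \<in> subalg deg S"
| add: "x \<in> subalg deg S \<Longrightarrow> y \<in> subalg deg S \<Longrightarrow> x + y \<in> subalg deg S"
| scale: "x \<in> subalg deg S \<Longrightarrow> scl c x \<in> subalg deg S"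
| mult: "x \<in> subalg deg S \<Longrightarrow> y \<in> subalg deg S \<Longrightarrow> gmul deg x y \<in> subalg deg S"

section \<open>Differential graded algebras and minimal models\<close>

text \<open>Maps defined on an algebra \<open>Lam deg X\<close> are total functions of which only the values on
  \<open>Lam deg X\<close> matter.\<close>

definition linear_map_on :: "'i galg set \<Rightarrow> ('i galg \<Rightarrow> 'j galg) \<Rightarrow> bool" where
  "linear_map_on S f \<longleftrightarrow>
     (\<forall>p\<in>S. \<forall>q\<in>S. f (p + q) = f p + f q) \<and> (\<forall>c. \<forall>p\<in>S. f (scl c p) = scl c (f p))"

definition differential :: "('i::linorder \<Rightarrow> nat) \<Rightarrow> 'i set \<Rightarrow> ('i galg \<Rightarrow> 'i galg) \<Rightarrow> bool" where
  "differential deg X d \<longleftrightarrow>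
     (\<forall>p \<in> Lam deg X. d p \<in> Lam deg X) \<and>
     linear_map_on (Lam deg X) d \<and>
     (\<forall>k. \<forall>p \<in> Lam deg X. homog deg k p \<longrightarrow> homog deg (k + 1) (d p)) \<and>
     (\<forall>k. \<forall>p \<in> Lam deg X. \<forall>q \<in> Lam deg X. homog deg k p \<longrightarrow>
        d (gmul deg p q) = gmul deg (d p) q + scl ((- 1) ^ k) (gmul deg p (d q))) \<and>
     (\<forall>p \<in> Lam deg X. d (d p) = 0)"

definition dga_iso :: "('i::linorder \<Rightarrow> nat) \<Rightarrow> 'i set \<Rightarrow> ('i galg \<Rightarrow> 'i galg) \<Rightarrow>
    ('j::linorder \<Rightarrow> nat) \<Rightarrow> 'j set \<Rightarrow> ('j galg \<Rightarrow> 'j galg) \<Rightarrow> ('i galg \<Rightarrow> 'j galg) \<Rightarrow> bool" where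
  "dga_iso deg X d deg' X' d' f \<longleftrightarrow>
     bij_betw f (Lam deg X) (Lam deg' X') \<and>
     linear_map_on (Lam deg X) f \<and>
     f gone = gone \<and>
     (\<forall>p \<in> Lam deg X. \<forall>q \<in> Lam deg X. f (gmul deg p q) = gmul deg' (f p) (f q)) \<and>
     (\<forall>k. \<forall>p \<in> Lam deg X. homog deg k p \<longrightarrow> homog deg' k (f p)) \<and>
     (\<forall>p \<in> Lam deg X. f (d p) = d' (f p))"

text \<open>Cocycles modulo coboundaries are spanned by finitely many classes.\<close>

definition finite_dim_cohomology ::
    "('i \<Rightarrow> nat) \<Rightarrow> 'i set \<Rightarrow> ('i galg \<Rightarrow> 'i galg) \<Rightarrow> bool" where
  "finite_dim_cohomology deg X d \<longleftrightarrow>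
     (\<exists>S. finite S \<and> S \<subseteq> {z \<in> Lam deg X. d z = 0} \<and>
        (\<forall>z \<in> Lam deg X. d z = 0 \<longrightarrow> (\<exists>s \<in> ratvec.span S. z - s \<in> d ` Lam deg X)))"

text \<open>All models are 1-connected: generators have degree at least 2.\<close>

definition minimal_model :: "('i::linorder \<Rightarrow> nat) \<Rightarrow> 'i set \<Rightarrow> ('i galg \<Rightarrow> 'i galg) \<Rightarrow> bool" where
  "minimal_model deg X d \<longleftrightarrow>
     (\<forall>i\<in>X. 2 \<le> deg i) \<and> differential deg X d \<and>
     (\<forall>w \<in> lin X. \<forall>m \<in> Poly_Mapping.keys (d w). size m \<noteq> 1)"

definition elliptic :: "('i \<Rightarrow> nat) \<Rightarrow> 'i set \<Rightarrow> ('i galg \<Rightarrow> 'i galg) \<Rightarrow> bool" where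
  "elliptic deg X d \<longleftrightarrow> finite X \<and> finite_dim_cohomology deg X d"

definition two_stage ::
    "('i::linorder \<Rightarrow> nat) \<Rightarrow> 'i set \<Rightarrow> 'i set \<Rightarrow> ('i galg \<Rightarrow> 'i galg) \<Rightarrow> bool" where
  "two_stage deg U V d \<longleftrightarrow>
     U \<inter> V = {} \<and> minimal_model deg (U \<union> V) d \<and>
     (\<forall>u \<in> lin U. d u = 0) \<and> (\<forall>v \<in> lin V. d v \<in> Lam deg U)"

text \<open>An isomorphism of minimal models induces a degree-preserving isomorphism of the spaces of
  generators, so taking the generators of the competing models from the same type loses nothing.\<close>

definition displays_max ::
    "('i::linorder \<Rightarrow> nat) \<Rightarrow> 'i set \<Rightarrow> 'i set \<Rightarrow> ('i galg \<Rightarrow> 'i galg) \<Rightarrow> bool" where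
  "displays_max deg U V d \<longleftrightarrow>
     (\<forall>(deg' :: 'i \<Rightarrow> nat) U' V' d'. two_stage deg' U' V' d' \<longrightarrow>
        (\<exists>f. dga_iso deg' (U' \<union> V') d' deg (U \<union> V) d f) \<longrightarrow>
        ratvec.dim (lin V') \<le> ratvec.dim (lin V))"

section \<open>Connectivity\<close>

definition odd_part :: "('i \<Rightarrow> nat) \<Rightarrow> 'i set \<Rightarrow> 'i set" where
  "odd_part deg X = {i\<in>X. odd (deg i)}"

definition even_part :: "('i \<Rightarrow> nat) \<Rightarrow> 'i set \<Rightarrow> 'i set" where
  "even_part deg X = {i\<in>X. even (deg i)}"

definition n_connected :: "int \<Rightarrow> ('i \<Rightarrow> nat) \<Rightarrow> 'i set \<Rightarrow> bool" where
  "n_connected n deg X \<longleftrightarrow> (\<forall>k. int k \<le> n \<longrightarrow> {z \<in> lin X. homog deg k z} = {0})"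

definition n_co_connected :: "int \<Rightarrow> ('i \<Rightarrow> nat) \<Rightarrow> 'i set \<Rightarrow> bool" where
  "n_co_connected n deg X \<longleftrightarrow> (\<forall>k. int k \<ge> n \<longrightarrow> {z \<in> lin X. homog deg k z} = {0})"

section \<open>Rational toral rank\<close>

text \<open>The algebra \<open>\<Lambda>A\<^sub>n \<otimes> \<Lambda>W\<close> is the free graded commutative algebra on the disjoint union of the
  generators \<open>Inl j\<close> with \<open>j < n\<close>, of degree 2, and \<open>Inr i\<close> with \<open>i\<close> a generator of \<open>W\<close>. The quotient
  map by the ideal generated by \<open>A\<^sub>n\<close> keeps the coefficients of the monomials without \<open>Inl\<close>.\<close>

definition ext_deg :: "('i \<Rightarrow> nat) \<Rightarrow> nat + 'i \<Rightarrow> nat" where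
  "ext_deg deg = case_sum (\<lambda>_. 2) deg"

definition ext_gens :: "nat \<Rightarrow> 'i set \<Rightarrow> (nat + 'i) set" where
  "ext_gens n X = Inl ` {..<n} \<union> Inr ` X"

definition ext_proj :: "(nat + 'i) galg \<Rightarrow> 'i galg" where
  "ext_proj = Poly_Mapping.map_key (image_mset Inr)"

lemma inj_image_mset_Inr: "inj (image_mset Inr)"
proof (rule injI)
  fix m n :: "'a multiset"
  assume "image_mset Inr m = (image_mset Inr n :: ('b + 'a) multiset)"
  then have "image_mset projr (image_mset Inr m :: ('b + 'a) multiset)
    = image_mset projr (image_mset Inr n :: ('b + 'a) multiset)"
    by (rule arg_cong)
  then show "m = n" by (simp add: multiset.map_comp o_def)
qed

lemma lookup_ext_proj:
  "Poly_Mapping.lookup (ext_proj p) m = Poly_Mapping.lookup p (image_mset Inr m)"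
  by (simp add: ext_proj_def map_key.rep_eq[OF inj_image_mset_Inr])

text \<open>The ordered basis is a finite or infinite sequence of homogeneous elements of \<open>W\<close>, indexed by
  an initial segment \<open>J\<close> of the natural numbers.\<close>

definition KS_extension :: "('i::linorder \<Rightarrow> nat) \<Rightarrow> 'i set \<Rightarrow> ('i galg \<Rightarrow> 'i galg) \<Rightarrow> nat \<Rightarrow>
    ((nat + 'i) galg \<Rightarrow> (nat + 'i) galg) \<Rightarrow> bool" where
  "KS_extension deg X d n D \<longleftrightarrow>
     differential (ext_deg deg) (ext_gens n X) D \<and>
     (\<forall>j<n. D (gen (Inl j)) = 0) \<and>
     (\<forall>p \<in> Lam (ext_deg deg) (ext_gens n X). ext_proj (D p) = d (ext_proj p)) \<and>
     (\<exists>(J :: nat set) w.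
        (\<forall>j\<in>J. \<forall>i<j. i \<in> J) \<and>
        inj_on w J \<and> ratvec.independent (w ` J) \<and> ratvec.span (w ` J) = lin (Inr ` X) \<and>
        (\<forall>j\<in>J. \<exists>k. homog (ext_deg deg) k (w j)) \<and>
        (\<forall>j\<in>J. D (w j) \<in> subalg (ext_deg deg) (gen ` Inl ` {..<n} \<union> w ` {..<j})))"

text \<open>The largest \<open>n\<close> is taken as a supremum in the extended naturals, so that no bound is
  presupposed.\<close>

definition toral_rank :: "('i::linorder \<Rightarrow> nat) \<Rightarrow> 'i set \<Rightarrow> ('i galg \<Rightarrow> 'i galg) \<Rightarrow> enat" where
  "toral_rank deg X d = Sup {enat n | n. \<exists>D. KS_extension deg X d n D \<and>
     finite_dim_cohomology (ext_deg deg) (ext_gens n X) D}"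

end

theory Submission
  imports Defs "HOL-Library.FuncSet"
begin

text \<open>
  Let \<open>D\<close> be a differential on \<open>\<Lambda>A\<^sub>n \<otimes> \<Lambda>(U,V)\<close> with finite-dimensional cohomology. The space \<open>V\<close> is
  concentrated in odd degrees (\<open>V_odd\<close>), so the even generators are \<open>Q = A\<^sub>n \<union> U\<^sup>e\<^sup>v\<^sup>e\<^sup>n\<close> and \<open>\<Lambda>Q\<close> is an
  ordinary polynomial ring. For a generator \<open>x\<close> let \<open>f x \<in> \<Lambda>Q\<close> be the part of \<open>D x\<close> without odd
  generators. The polynomials \<open>f x\<close> with \<open>x\<close> odd generate an ideal of finite codimension: a power
  of each \<open>a \<in> A\<^sub>n\<close> is the coboundary of some element, hence lies in the ideal, and a power of each
  \<open>u \<in> U\<^sup>e\<^sup>v\<^sup>e\<^sup>n\<close> is a coboundary in \<open>\<Lambda>(U,V)\<close>, hence lies in the ideal modulo \<open>A\<^sub>n\<close>. Comparing the growth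
  of the numbers of monomials, a polynomial ring with a finite-dimensional quotient by \<open>k\<close>
  homogeneous polynomials of positive degree has at most \<open>k\<close> variables (\<open>card_generators_le\<close>).
  Applied to all odd generators this only bounds \<open>n + dim U\<^sup>e\<^sup>v\<^sup>e\<^sup>n\<close> by \<open>dim V + dim U\<^sup>o\<^sup>d\<^sup>d\<close>. What has to be
  shown is that \<open>U\<^sup>o\<^sup>d\<^sup>d\<close> contributes nothing: \<open>f u\<close> lies in the ideal \<open>J\<close> generated by the \<open>f v\<close>
  with \<open>v \<in> V\<close> (\<open>odd_values_in_ideal\<close>).

  This goes by induction on the degree \<open>k\<close> of \<open>u\<close>. Take \<open>v \<in> V\<close> and \<open>w \<in> U\<^sup>o\<^sup>d\<^sup>d\<close> and compare the
  coefficients of \<open>w\<close> in the equation \<open>D(D v) = 0\<close>, modulo products of two or more odd generators.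
  The degree hypothesis (A) or (B) makes the contribution of the even generators vanish. What is
  left says that \<open>\<Sum>\<^sub>i c\<^sub>i f(u\<^sub>i) \<in> J\<close>, where \<open>\<Sum>\<^sub>i c\<^sub>i u\<^sub>i\<close> is the contraction of the quadratic form \<open>d v\<close>
  with the coordinate of \<open>w\<close> (\<open>contraction_in_ideal\<close>). If some \<open>f u\<close> were not in \<open>J\<close>, a linear
  functional \<open>l\<close> that vanishes on \<open>J\<close> but not at \<open>f u\<close> would give the nonzero functional
  \<open>\<phi>(u\<^sub>i) = l(f(u\<^sub>i))\<close> on the part of \<open>U\<^sup>o\<^sup>d\<^sup>d\<close> of degree \<open>k\<close> whose contraction with every \<open>d v\<close> is zero.
  Then \<open>d V \<subseteq> \<Lambda>\<^sup>2 (ker \<phi>)\<close>, and a complement of \<open>ker \<phi>\<close> can be moved from \<open>U\<close> to \<open>V\<close>, which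
  contradicts the maximality of \<open>V\<close> (\<open>maximal_imp_no_free_direction\<close>).

  Both alternatives of the degree hypothesis reduce to the same fact: as all generators have degree
  at least 2, \<open>D w\<close> has no linear term for any generator \<open>w\<close> of \<open>\<Lambda>(U,V)\<close> (\<open>keys_D\<close>).
\<close>

abbreviation lookup :: "('k \<Rightarrow>\<^sub>0 rat) \<Rightarrow> 'k \<Rightarrow> rat" where "lookup \<equiv> Poly_Mapping.lookup"
abbreviation keys :: "('k \<Rightarrow>\<^sub>0 rat) \<Rightarrow> 'k set" where "keys \<equiv> Poly_Mapping.keys"
abbreviation mon :: "'k \<Rightarrow> ('k \<Rightarrow>\<^sub>0 rat)" where "mon m \<equiv> Poly_Mapping.single m 1"
abbreviation mdeg :: "('i \<Rightarrow> nat) \<Rightarrow> 'i multiset \<Rightarrow> nat" where "mdeg deg m \<equiv> (\<Sum>i\<in>#m. deg i)"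

text \<open>As a rewrite rule, this would turn the unit monomial into the unit of the commutative
  product and so hide it from the rules about monomials.\<close>

declare single_one [simp del]

section \<open>Subspaces spanned by monomials and linear maps\<close>

definition supp :: "'k set \<Rightarrow> ('k \<Rightarrow>\<^sub>0 rat) set" where
  "supp M = {p. keys p \<subseteq> M}"

lemma supp_iff: "p \<in> supp M \<longleftrightarrow> (\<forall>m. m \<notin> M \<longrightarrow> lookup p m = 0)"
  by (auto simp: supp_def in_keys_iff)

lemma supp_mono: "M \<subseteq> N \<Longrightarrow> p \<in> supp M \<Longrightarrow> p \<in> supp N"
  by (auto simp: supp_def)

lemma supp_UNIV [simp]: "supp UNIV = UNIV"
  by (simp add: supp_def)

lemma mon_in_supp [simp]: "mon m \<in> supp M \<longleftrightarrow> m \<in> M"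
  by (simp add: supp_def)

lemma subspace_supp: "ratvec.subspace (supp M)"
  by (rule ratvec.subspaceI) (auto simp: supp_iff lookup_add lookup_scl)

lemma zero_in_supp [simp]: "0 \<in> supp M"
  by (simp add: supp_iff)

lemma supp_add: "p \<in> supp M \<Longrightarrow> q \<in> supp M \<Longrightarrow> p + q \<in> supp M"
  by (rule ratvec.subspace_add[OF subspace_supp])

lemma supp_scl: "p \<in> supp M \<Longrightarrow> scl c p \<in> supp M"
  by (rule ratvec.subspace_scale[OF subspace_supp])

lemma supp_diff: "p \<in> supp M \<Longrightarrow> q \<in> supp M \<Longrightarrow> p - q \<in> supp M"
  by (rule ratvec.subspace_diff[OF subspace_supp])

lemma scl_single: "scl c (Poly_Mapping.single m b) = Poly_Mapping.single m (c * b)"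
  by (rule poly_mapping_eqI) (simp add: lookup_scl lookup_single when_def)

lemma sum_mon: "p = (\<Sum>m\<in>keys p. scl (lookup p m) (mon m))"
  by (rule poly_mapping_eqI)
     (simp add: lookup_sum lookup_scl lookup_single when_def in_keys_iff if_distrib cong: if_cong)

lemma supp_induct [consumes 1, case_names mon zero add scl]:
  assumes "p \<in> supp M"
    and mon: "\<And>m. m \<in> M \<Longrightarrow> P (mon m)"
    and zero: "P 0"
    and add: "\<And>p q. p \<in> supp M \<Longrightarrow> q \<in> supp M \<Longrightarrow> P p \<Longrightarrow> P q \<Longrightarrow> P (p + q)"
    and scl: "\<And>c p. p \<in> supp M \<Longrightarrow> P p \<Longrightarrow> P (scl c p)"
  shows "P p"
proof -
  have "A \<subseteq> M \<Longrightarrow> P (\<Sum>m\<in>A. scl (lookup p m) (mon m)) \<and> (\<Sum>m\<in>A. scl (lookup p m) (mon m)) \<in> supp M"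
    if "finite A" for A
    using that
    by (induction A rule: finite_induct) (auto intro!: zero add scl mon supp_add supp_scl)
  from this[of "keys p"] show ?thesis
    using assms(1) sum_mon[of p] by (auto simp: supp_def)
qed

lemma supp_in_subspace:
  assumes "p \<in> supp M" "ratvec.subspace W" "\<And>m. m \<in> M \<Longrightarrow> mon m \<in> W"
  shows "p \<in> W"
  using assms(1)
  by (induction rule: supp_induct)
     (auto intro: assms ratvec.subspace_add ratvec.subspace_scale ratvec.subspace_0)

lemma linear_map_onD:
  assumes "linear_map_on S f"
  shows "p \<in> S \<Longrightarrow> q \<in> S \<Longrightarrow> f (p + q) = f p + f q"
    and "p \<in> S \<Longrightarrow> f (scl c p) = scl c (f p)"
  using assms by (auto simp: linear_map_on_def)

lemma linear_map_on_subset: "linear_map_on S f \<Longrightarrow> T \<subseteq> S \<Longrightarrow> linear_map_on T f"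
  unfolding linear_map_on_def by blast

lemma linear_map_on_zero:
  assumes "linear_map_on S f" "ratvec.subspace S"
  shows "f 0 = 0"
  using linear_map_onD(2)[OF assms(1) ratvec.subspace_0[OF assms(2)], of 0] by simp

lemma linear_map_on_diff:
  assumes "linear_map_on S f" "ratvec.subspace S" "p \<in> S" "q \<in> S"
  shows "f (p - q) = f p - f q"
proof -
  have "f ((p - q) + q) = f (p - q) + f q"
    by (intro linear_map_onD(1)[OF assms(1)] ratvec.subspace_diff assms)
  then show ?thesis by simp
qed

lemma linear_map_on_sum:
  assumes "linear_map_on S f" "ratvec.subspace S" "\<And>i. i \<in> I \<Longrightarrow> g i \<in> S"
  shows "f (\<Sum>i\<in>I. g i) = (\<Sum>i\<in>I. f (g i))"
  using assms(3)
  by (induction I rule: infinite_finite_induct)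
     (auto simp: linear_map_on_zero[OF assms(1,2)] linear_map_onD[OF assms(1)]
       ratvec.subspace_sum[OF assms(2)])

lemma linear_map_on_eq:
  assumes "p \<in> supp M" "linear_map_on (supp M) f" "linear_map_on (supp M) g"
    and "\<And>m. m \<in> M \<Longrightarrow> f (mon m) = g (mon m)"
  shows "f p = g p"
  using assms(1)
  by (induction rule: supp_induct)
     (auto simp: assms(4) linear_map_onD[OF assms(2)] linear_map_onD[OF assms(3)]
       linear_map_on_zero[OF assms(2) subspace_supp] linear_map_on_zero[OF assms(3) subspace_supp])

lemma linear_map_on_into:
  assumes "p \<in> supp M" "linear_map_on (supp M) f" "ratvec.subspace W"
    and "\<And>m. m \<in> M \<Longrightarrow> f (mon m) \<in> W"
  shows "f p \<in> W"
  using assms(1)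
  by (induction rule: supp_induct)
     (auto simp: assms(4) linear_map_onD[OF assms(2)] linear_map_on_zero[OF assms(2) subspace_supp]
       intro: ratvec.subspace_add[OF assms(3)] ratvec.subspace_scale[OF assms(3)]
         ratvec.subspace_0[OF assms(3)])

lemma linear_map_on_compose:
  assumes "linear_map_on S f" "linear_map_on T g" "\<And>p. p \<in> S \<Longrightarrow> f p \<in> T"
  shows "linear_map_on S (\<lambda>p. g (f p))"
  using assms by (auto simp: linear_map_on_def)

definition lext :: "('i multiset \<Rightarrow> 'j galg) \<Rightarrow> 'i galg \<Rightarrow> 'j galg" where
  "lext f p = (\<Sum>m\<in>keys p. scl (lookup p m) (f m))"

lemma lext_eq_sum:
  assumes "finite A" "keys p \<subseteq> A"
  shows "lext f p = (\<Sum>m\<in>A. scl (lookup p m) (f m))"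
  unfolding lext_def using assms
  by (intro sum.mono_neutral_left) (auto simp: in_keys_iff)

lemma linear_lext: "linear_map_on S (lext f)"
  unfolding linear_map_on_def
proof (intro conjI ballI allI)
  fix p q :: "'a galg"
  have "keys (p + q) \<subseteq> keys p \<union> keys q" by (rule keys_add)
  then show "lext f (p + q) = lext f p + lext f q"
    by (simp add: lext_eq_sum[where A = "keys p \<union> keys q"] lookup_add ratvec.scale_left_distrib sum.distrib)
next
  fix c and p :: "'a galg"
  have "keys (scl c p) \<subseteq> keys p" by (auto simp: in_keys_iff lookup_scl)
  then show "lext f (scl c p) = scl c (lext f p)"
    by (simp add: lext_eq_sum[where A = "keys p"] lookup_scl ratvec.scale_sum_right)
qed

lemma lext_mon [simp]: "lext f (mon m) = f m"
  by (simp add: lext_def)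

lemmas lext_add = linear_map_onD(1)[OF linear_lext UNIV_I UNIV_I]
lemmas lext_scl = linear_map_onD(2)[OF linear_lext UNIV_I]
lemmas lext_zero = linear_map_on_zero[OF linear_lext ratvec.subspace_UNIV]
lemmas lext_diff = linear_map_on_diff[OF linear_lext ratvec.subspace_UNIV UNIV_I UNIV_I]
lemmas lext_sum = linear_map_on_sum[OF linear_lext ratvec.subspace_UNIV UNIV_I]

section \<open>The graded product\<close>

lemma gmul_eq_sum:
  assumes "finite A" "keys p \<subseteq> A" "finite B" "keys q \<subseteq> B"
  shows "gmul deg p q = (\<Sum>m\<in>A. \<Sum>n\<in>B.
     Poly_Mapping.single (m + n) (mono_sign deg m n * lookup p m * lookup q n))"
proof -
  have "gmul deg p q = (\<Sum>m\<in>keys p. \<Sum>n\<in>B.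
     Poly_Mapping.single (m + n) (mono_sign deg m n * lookup p m * lookup q n))"
    unfolding gmul_def using assms
    by (intro sum.cong refl sum.mono_neutral_left) (auto simp: in_keys_iff)
  also have "\<dots> = (\<Sum>m\<in>A. \<Sum>n\<in>B.
     Poly_Mapping.single (m + n) (mono_sign deg m n * lookup p m * lookup q n))"
    using assms by (intro sum.mono_neutral_left) (auto simp: in_keys_iff)
  finally show ?thesis .
qed

lemma gmul_add_left: "gmul deg (p + p') q = gmul deg p q + gmul deg p' q"
proof -
  have "keys (p + p') \<subseteq> keys p \<union> keys p'" by (rule keys_add)
  then show ?thesis
    by (simp add: gmul_eq_sum[where A = "keys p \<union> keys p'" and B = "keys q"] lookup_add
        single_add sum.distrib algebra_simps)
qed

lemma gmul_add_right: "gmul deg p (q + q') = gmul deg p q + gmul deg p q'"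
proof -
  have "keys (q + q') \<subseteq> keys q \<union> keys q'" by (rule keys_add)
  then show ?thesis
    by (simp add: gmul_eq_sum[where B = "keys q \<union> keys q'" and A = "keys p"] lookup_add
        single_add sum.distrib algebra_simps)
qed

lemma gmul_scl_left: "gmul deg (scl c p) q = scl c (gmul deg p q)"
proof -
  have "keys (scl c p) \<subseteq> keys p" by (auto simp: in_keys_iff lookup_scl)
  then show ?thesis
    by (simp add: gmul_eq_sum[where A = "keys p" and B = "keys q"] lookup_scl
        ratvec.scale_sum_right scl_single algebra_simps)
qed

lemma gmul_scl_right: "gmul deg p (scl c q) = scl c (gmul deg p q)"
proof -
  have "keys (scl c q) \<subseteq> keys q" by (auto simp: in_keys_iff lookup_scl)
  then show ?thesis
    by (simp add: gmul_eq_sum[where A = "keys p" and B = "keys q"] lookup_scl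
        ratvec.scale_sum_right scl_single algebra_simps)
qed

lemma gmul_zero_left [simp]: "gmul deg 0 q = 0" by (simp add: gmul_def)
lemma gmul_zero_right [simp]: "gmul deg p 0 = 0" by (simp add: gmul_def)

lemma linear_gmul_left: "linear_map_on S (\<lambda>p. gmul deg p q)"
  by (simp add: linear_map_on_def gmul_add_left gmul_scl_left)

lemma linear_gmul_right: "linear_map_on S (gmul deg p)"
  by (simp add: linear_map_on_def gmul_add_right gmul_scl_right)

lemmas gmul_diff_left = linear_map_on_diff[OF linear_gmul_left ratvec.subspace_UNIV UNIV_I UNIV_I]
lemmas gmul_diff_right = linear_map_on_diff[OF linear_gmul_right ratvec.subspace_UNIV UNIV_I UNIV_I]
lemmas gmul_sum_right = linear_map_on_sum[OF linear_gmul_right ratvec.subspace_UNIV UNIV_I]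
lemmas gmul_sum_left = linear_map_on_sum[OF linear_gmul_left ratvec.subspace_UNIV UNIV_I]

lemma gmul_mon: "gmul deg (mon m) (mon n) = scl (mono_sign deg m n) (mon (m + n))"
  by (simp add: gmul_def scl_single)

text \<open>The sign depends only on the odd generators that occur.\<close>

definition odds :: "('i \<Rightarrow> nat) \<Rightarrow> 'i multiset \<Rightarrow> 'i set" where
  "odds deg m = {i. i \<in># m \<and> odd (deg i)}"

definition invs :: "'i::linorder set \<Rightarrow> 'i set \<Rightarrow> nat" where
  "invs A B = card {(i, j). i \<in> A \<and> j \<in> B \<and> j < i}"

lemma finite_odds [simp]: "finite (odds deg m)"
  by (rule finite_subset[of _ "set_mset m"]) (auto simp: odds_def)

lemma odds_plus [simp]: "odds deg (m + n) = odds deg m \<union> odds deg n"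
  by (auto simp: odds_def)

lemma odds_empty [simp]: "odds deg {#} = {}"
  by (simp add: odds_def)

lemma odds_single: "odds deg {#i#} = (if odd (deg i) then {i} else {})"
  by (auto simp: odds_def)

lemma odds_add_mset: "odds deg (add_mset i m) = (if odd (deg i) then {i} else {}) \<union> odds deg m"
  by (auto simp: odds_def)

lemma mono_sign_odds:
  "mono_sign deg m n = (if odds deg m \<inter> odds deg n = {} then (-1) ^ invs (odds deg m) (odds deg n) else 0)"
proof -
  have "{(i, j). i \<in># m \<and> j \<in># n \<and> odd (deg i) \<and> odd (deg j) \<and> j < i} =
    {(i, j). i \<in> odds deg m \<and> j \<in> odds deg n \<and> j < i}"
    by (auto simp: odds_def)
  then show ?thesis
    by (auto simp: mono_sign_def invs_def odds_def)
qed

lemma finite_inv_pairs: "finite A \<Longrightarrow> finite B \<Longrightarrow> finite {(i, j). i \<in> A \<and> j \<in> B \<and> j < (i::'i::linorder)}"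
  by (rule finite_subset[of _ "A \<times> B"]) auto

lemma invs_Un_left:
  assumes "finite A" "finite B" "finite C" "A \<inter> B = {}"
  shows "invs (A \<union> B) C = invs A C + invs B C"
proof -
  have "{(i, j). i \<in> A \<union> B \<and> j \<in> C \<and> j < i} =
     {(i, j). i \<in> A \<and> j \<in> C \<and> j < i} \<union> {(i, j). i \<in> B \<and> j \<in> C \<and> j < i}" by auto
  then show ?thesis unfolding invs_def
    using assms by (simp only:) (subst card_Un_disjoint; auto intro: finite_inv_pairs)
qed

lemma invs_Un_right:
  assumes "finite A" "finite B" "finite C" "A \<inter> B = {}"
  shows "invs C (A \<union> B) = invs C A + invs C B"
proof -
  have "{(i, j). i \<in> C \<and> j \<in> A \<union> B \<and> j < i} =
     {(i, j). i \<in> C \<and> j \<in> A \<and> j < i} \<union> {(i, j). i \<in> C \<and> j \<in> B \<and> j < i}" by auto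
  then show ?thesis unfolding invs_def
    using assms by (simp only:) (subst card_Un_disjoint; auto intro: finite_inv_pairs)
qed

lemma invs_swap:
  assumes "finite A" "finite B" "A \<inter> B = {}"
  shows "invs A B + invs B A = card A * card B"
proof -
  let ?X = "{(i, j). i \<in> A \<and> j \<in> B \<and> j < i}" and ?Y = "{(i, j). i \<in> B \<and> j \<in> A \<and> j < i}"
  have "A \<times> B = ?X \<union> prod.swap ` ?Y"
    using assms(3) by (auto simp: image_iff)
  moreover have "?X \<inter> prod.swap ` ?Y = {}" by auto
  moreover have "card (prod.swap ` ?Y) = card ?Y" by (rule card_image) (auto simp: inj_on_def)
  ultimately have "card (A \<times> B) = card ?X + card ?Y"
    using assms by (simp only:) (subst card_Un_disjoint; simp add: finite_inv_pairs)
  then show ?thesis by (simp add: invs_def card_cartesian_product)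
qed

lemma invs_empty [simp]: "invs {} B = 0" "invs A {} = 0"
  by (simp_all add: invs_def)

text \<open>Inversions between disjoint sets are additive in both arguments, so both sides count the
  same pairs; and both vanish as soon as two of the three monomials share an odd generator.\<close>

lemma mono_sign_cocycle:
  "mono_sign deg m n * mono_sign deg (m + n) k = mono_sign deg n k * mono_sign deg m (n + k)"
  by (simp add: mono_sign_odds invs_Un_left invs_Un_right Int_Un_distrib Int_Un_distrib2 power_add)

lemma mono_sign_swap:
  "mono_sign deg m n = (-1) ^ (card (odds deg m) * card (odds deg n)) * mono_sign deg n m"
proof (cases "odds deg m \<inter> odds deg n = {}")
  case True
  then have "invs (odds deg m) (odds deg n) + invs (odds deg n) (odds deg m)
     = card (odds deg m) * card (odds deg n)" by (intro invs_swap) auto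
  then show ?thesis using True
    by (simp add: mono_sign_odds Int_commute power_add flip: \<open>_ = card _ * card _\<close>)
next
  case False
  then show ?thesis by (simp add: mono_sign_odds Int_commute)
qed

lemma gmul_assoc: "gmul deg (gmul deg p q) r = gmul deg p (gmul deg q r)"
proof -
  have 1: "gmul deg (gmul deg (mon m) (mon n)) (mon k) = gmul deg (mon m) (gmul deg (mon n) (mon k))" for m n k
    by (simp add: gmul_mon gmul_scl_left gmul_scl_right mono_sign_cocycle mult.commute add.assoc)
  have lin1: "linear_map_on (supp UNIV) (\<lambda>r. gmul deg (gmul deg p q) r)"
    "linear_map_on (supp UNIV) (\<lambda>r. gmul deg p (gmul deg q r))" for p q
    by (auto simp: linear_map_on_def gmul_add_right gmul_scl_right)
  have 2: "gmul deg (gmul deg (mon m) (mon n)) r = gmul deg (mon m) (gmul deg (mon n) r)" for m n r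
    by (rule linear_map_on_eq[of r UNIV]) (auto simp: 1 linear_map_on_def gmul_add_right gmul_scl_right)
  have 3: "gmul deg (gmul deg (mon m) q) r = gmul deg (mon m) (gmul deg q r)" for m q r
    by (rule linear_map_on_eq[of q UNIV])
       (auto simp: 2 linear_map_on_def gmul_add_right gmul_scl_right gmul_add_left gmul_scl_left)
  show ?thesis
    by (rule linear_map_on_eq[of p UNIV])
       (auto simp: 3 linear_map_on_def gmul_add_left gmul_scl_left)
qed

lemma mono_sign_empty [simp]: "mono_sign deg {#} n = 1" "mono_sign deg m {#} = 1"
  by (simp_all add: mono_sign_odds)

lemma gone_mon: "gone = mon {#}" by (simp add: gone_def)
lemma gen_mon: "gen i = mon {#i#}" by (simp add: gen_def)

lemma gmul_gone_left [simp]: "gmul deg gone p = p"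
  by (rule linear_map_on_eq[of p UNIV])
     (auto simp: gone_mon gmul_mon linear_map_on_def gmul_add_right gmul_scl_right)

lemma gmul_gone_right [simp]: "gmul deg p gone = p"
  by (rule linear_map_on_eq[of p UNIV])
     (auto simp: gone_mon gmul_mon linear_map_on_def gmul_add_left gmul_scl_left)

section \<open>Monomials of the free algebra\<close>

definition mons :: "('i \<Rightarrow> nat) \<Rightarrow> 'i set \<Rightarrow> 'i multiset set" where
  "mons deg X = {m. set_mset m \<subseteq> X \<and> (\<forall>i. odd (deg i) \<longrightarrow> count m i \<le> 1)}"

lemma Lam_supp: "Lam deg X = supp (mons deg X)"
  by (auto simp: Lam_def supp_def mons_def)

lemma homog_supp: "homog deg k p \<longleftrightarrow> p \<in> supp {m. mdeg deg m = k}"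
  by (auto simp: homog_def supp_def)

lemma subspace_Lam: "ratvec.subspace (Lam deg X)"
  by (simp add: Lam_supp subspace_supp)

lemma supp_Int: "supp M \<inter> supp N = supp (M \<inter> N)"
  by (auto simp: supp_def)

lemma mon_in_Lam [simp]: "mon m \<in> Lam deg X \<longleftrightarrow> m \<in> mons deg X"
  by (simp add: Lam_supp)

lemma mons_plusD: "m + n \<in> mons deg X \<Longrightarrow> m \<in> mons deg X \<and> n \<in> mons deg X"
  by (fastforce simp: mons_def dest: add_leD1 add_leD2)

lemma mons_add_msetD: "add_mset i m \<in> mons deg X \<Longrightarrow> i \<in> X \<and> m \<in> mons deg X"
  using mons_plusD[of "{#i#}" m deg X] by (auto simp: mons_def)

lemma mons_add_mset_odd: "add_mset i m \<in> mons deg X \<Longrightarrow> odd (deg i) \<Longrightarrow> i \<notin># m"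
  by (auto simp: mons_def simp flip: count_eq_zero_iff dest: spec[of _ i])

lemma mons_subset: "m \<in> mons deg X \<Longrightarrow> n \<subseteq># m \<Longrightarrow> n \<in> mons deg X"
  by (metis mons_plusD subset_mset.add_diff_inverse)

lemma mons_plusI:
  assumes "m \<in> mons deg X" "n \<in> mons deg X" "odds deg m \<inter> odds deg n = {}"
  shows "m + n \<in> mons deg X"
  unfolding mons_def
proof (intro CollectI conjI allI impI)
  show "set_mset (m + n) \<subseteq> X" using assms by (auto simp: mons_def)
  fix i assume "odd (deg i)"
  with assms have "count m i \<le> 1" "count n i \<le> 1" "i \<notin># m \<or> i \<notin># n"
    by (auto simp: mons_def odds_def)
  then show "count (m + n) i \<le> 1" by (auto simp: not_in_iff)
qed

lemma mons_mset_subset: "X \<subseteq> Y \<Longrightarrow> m \<in> mons deg X \<Longrightarrow> m \<in> mons deg Y"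
  by (auto simp: mons_def)

lemma empty_in_mons [simp]: "{#} \<in> mons deg X"
  by (simp add: mons_def)

lemma mons_single: "{#i#} \<in> mons deg X \<longleftrightarrow> i \<in> X"
  by (auto simp: mons_def)

lemma gmul_in_supp:
  assumes "p \<in> supp M" "q \<in> supp N"
    and "\<And>m n. m \<in> M \<Longrightarrow> n \<in> N \<Longrightarrow> mono_sign deg m n \<noteq> 0 \<Longrightarrow> m + n \<in> K"
  shows "gmul deg p q \<in> supp K"
proof (rule linear_map_on_into[OF assms(1) linear_gmul_left subspace_supp])
  fix m assume m: "m \<in> M"
  show "gmul deg (mon m) q \<in> supp K"
  proof (rule linear_map_on_into[OF assms(2) linear_gmul_right subspace_supp])
    fix n assume "n \<in> N"
    with m assms(3)[of m n] show "gmul deg (mon m) (mon n) \<in> supp K"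
      by (cases "mono_sign deg m n = 0") (auto simp: gmul_mon intro: supp_scl)
  qed
qed

lemma gmul_Lam:
  assumes "p \<in> Lam deg X" "q \<in> Lam deg X"
  shows "gmul deg p q \<in> Lam deg X"
  using assms unfolding Lam_supp
  by (rule gmul_in_supp) (auto simp: mono_sign_odds split: if_splits intro: mons_plusI)

lemma gmul_homog:
  assumes "homog deg k p" "homog deg l q"
  shows "homog deg (k + l) (gmul deg p q)"
  using assms unfolding homog_supp by (rule gmul_in_supp) auto

text \<open>In a monomial of the free algebra the odd generators are distinct, so their number has the
  parity of the degree.\<close>

lemma mons_parity:
  "m \<in> mons deg X \<Longrightarrow> even (mdeg deg m) \<longleftrightarrow> even (card (odds deg m))"
proof (induction m)
  case (add i m)
  then have *: "m \<in> mons deg X" "odd (deg i) \<Longrightarrow> i \<notin># m"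
    using mons_add_msetD[OF add.prems] mons_add_mset_odd[OF add.prems] by auto
  show ?case
  proof (cases "odd (deg i)")
    case True
    with * have "i \<notin> odds deg m" by (simp add: odds_def)
    then show ?thesis using True add.IH[OF *(1)] by (simp add: odds_add_mset)
  qed (use add.IH[OF *(1)] in \<open>simp add: odds_add_mset\<close>)
qed simp

lemma gmul_commute:
  assumes "p \<in> Lam deg X" "q \<in> Lam deg X" "homog deg k p" "homog deg l q"
  shows "gmul deg p q = scl ((-1) ^ (k * l)) (gmul deg q p)"
proof -
  have p: "p \<in> supp (mons deg X \<inter> {m. mdeg deg m = k})" and q: "q \<in> supp (mons deg X \<inter> {m. mdeg deg m = l})"
    using assms by (auto simp: Lam_supp homog_supp simp flip: supp_Int)
  have mn: "gmul deg (mon m) (mon n) = scl ((-1) ^ (k * l)) (gmul deg (mon n) (mon m))"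
    if "m \<in> mons deg X \<inter> {m. mdeg deg m = k}" "n \<in> mons deg X \<inter> {m. mdeg deg m = l}" for m n
  proof -
    have "(-1::rat) ^ (card (odds deg m) * card (odds deg n)) = (-1) ^ (k * l)"
      using mons_parity[of m deg X] mons_parity[of n deg X] that by (auto simp: minus_one_power_iff)
    then show ?thesis by (simp add: gmul_mon mono_sign_swap[of deg m n] add.commute)
  qed
  have lin: "linear_map_on S (\<lambda>p. scl c (gmul deg p q))" "linear_map_on S (\<lambda>p. scl c (gmul deg q p))" for S c q
    by (auto simp: linear_map_on_def gmul_add_left gmul_scl_left gmul_add_right gmul_scl_right
        ratvec.scale_right_distrib mult.commute)
  have "gmul deg (mon m) q = scl ((-1) ^ (k * l)) (gmul deg q (mon m))"
    if "m \<in> mons deg X \<inter> {m. mdeg deg m = k}" for m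
    by (rule linear_map_on_eq[OF q linear_gmul_right lin(1)]) (rule mn[OF that])
  then show ?thesis
    by (rule linear_map_on_eq[OF p linear_gmul_left lin(2)])
qed

text \<open>The sign is \<open>\<plusminus>1\<close> because a monomial of the free algebra contains an odd generator only once.
  This is the step that makes induction over monomials possible.\<close>

lemma mon_add_mset:
  assumes "add_mset i m \<in> mons deg X"
  shows "gmul deg (gen i) (mon m) = scl (mono_sign deg {#i#} m) (mon (add_mset i m))"
    and "mono_sign deg {#i#} m * mono_sign deg {#i#} m = 1"
    and "mon (add_mset i m) = scl (mono_sign deg {#i#} m) (gmul deg (gen i) (mon m))"
proof -
  show 1: "gmul deg (gen i) (mon m) = scl (mono_sign deg {#i#} m) (mon (add_mset i m))"
    by (simp add: gen_mon gmul_mon)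
  have "odd (deg i) \<Longrightarrow> i \<notin># m"
    by (rule mons_add_mset_odd[OF assms])
  then show 2: "mono_sign deg {#i#} m * mono_sign deg {#i#} m = 1"
    by (auto simp: mono_sign_odds odds_single odds_def simp flip: power_add)
  show "mon (add_mset i m) = scl (mono_sign deg {#i#} m) (gmul deg (gen i) (mon m))"
    by (simp add: 1 2)
qed


section \<open>Restriction to a set of monomials\<close>

definition restr :: "'i multiset set \<Rightarrow> 'i galg \<Rightarrow> 'i galg" where
  "restr M = lext (\<lambda>m. if m \<in> M then mon m else 0)"

lemma lookup_restr: "lookup (restr M p) m = (if m \<in> M then lookup p m else 0)"
proof -
  have "lookup (restr M p) m = (\<Sum>n\<in>keys p. lookup p n * (if n \<in> M then (1 when n = m) else 0))"
    unfolding restr_def lext_def lookup_sum lookup_scl by (rule sum.cong) (auto simp: lookup_single)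
  also have "\<dots> = (\<Sum>n\<in>keys p. if n = m then (if m \<in> M then lookup p m else 0) else 0)"
    by (rule sum.cong) (auto simp: when_def)
  also have "\<dots> = (if m \<in> M then lookup p m else 0)"
    by (auto simp: in_keys_iff)
  finally show ?thesis .
qed

lemma restr_in_supp [simp]: "restr M p \<in> supp M"
  by (simp add: supp_iff lookup_restr)

lemma restr_supp: "p \<in> supp N \<Longrightarrow> restr M p \<in> supp N"
  by (simp add: supp_iff lookup_restr)

lemma restr_id: "p \<in> supp M \<Longrightarrow> restr M p = p"
  by (rule poly_mapping_eqI) (auto simp: supp_iff lookup_restr)

lemma restr_zero_iff: "restr M p = 0 \<longleftrightarrow> p \<in> supp (- M)"
  by (auto simp: supp_iff lookup_restr poly_mapping_eq_iff fun_eq_iff)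

lemma linear_restr: "linear_map_on S (restr M)"
  unfolding restr_def by (rule linear_lext)

lemma restr_add: "restr M (p + q) = restr M p + restr M q"
  and restr_scl: "restr M (scl c p) = scl c (restr M p)"
  and restr_diff: "restr M (p - q) = restr M p - restr M q"
  and restr_zero [simp]: "restr M 0 = 0"
  by (simp_all add: restr_def lext_add lext_scl lext_diff lext_zero)

lemma restr_mon: "restr M (mon m) = (if m \<in> M then mon m else 0)"
  by (simp add: restr_def)

section \<open>Differentials\<close>

lemma homog_mon [simp]: "homog deg k (mon m) \<longleftrightarrow> mdeg deg m = k"
  by (simp add: homog_supp)

lemma homog_gen [simp]: "homog deg k (gen i) \<longleftrightarrow> deg i = k"
  by (simp add: gen_mon)

lemma gen_in_Lam [simp]: "gen i \<in> Lam deg X \<longleftrightarrow> i \<in> X"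
  by (simp add: gen_mon mons_single)

locale dga =
  fixes deg :: "'i::linorder \<Rightarrow> nat" and X :: "'i set" and D :: "'i galg \<Rightarrow> 'i galg"
  assumes differential: "differential deg X D"
begin

lemma D_Lam: "p \<in> Lam deg X \<Longrightarrow> D p \<in> Lam deg X"
  and D_linear: "linear_map_on (Lam deg X) D"
  and D_homog: "p \<in> Lam deg X \<Longrightarrow> homog deg k p \<Longrightarrow> homog deg (k + 1) (D p)"
  and D_gmul: "p \<in> Lam deg X \<Longrightarrow> q \<in> Lam deg X \<Longrightarrow> homog deg k p \<Longrightarrow>
        D (gmul deg p q) = gmul deg (D p) q + scl ((- 1) ^ k) (gmul deg p (D q))"
  and D_D: "p \<in> Lam deg X \<Longrightarrow> D (D p) = 0"
  using differential by (auto simp: differential_def)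

lemmas D_add = linear_map_onD(1)[OF D_linear]
lemmas D_scl = linear_map_onD(2)[OF D_linear]
lemmas D_diff = linear_map_on_diff[OF D_linear subspace_Lam]
lemmas D_sum = linear_map_on_sum[OF D_linear subspace_Lam]
lemmas D_zero = linear_map_on_zero[OF D_linear subspace_Lam]

lemma D_gone: "D gone = 0"
proof -
  have "gone \<in> Lam deg X" "homog deg 0 gone" by (simp_all add: gone_mon)
  from D_gmul[OF this(1) this(1) this(2), unfolded gmul_gone_left gmul_gone_right power_0 ratvec.scale_one]
  have "D gone + 0 = D gone + D gone" unfolding add_0_right .
  from add_left_imp_eq[OF this] show ?thesis by (rule sym)
qed

lemma D_mon_add_mset:
  assumes "add_mset i m \<in> mons deg X"
  shows "D (mon (add_mset i m)) = scl (mono_sign deg {#i#} m)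
    (gmul deg (D (gen i)) (mon m) + scl ((-1) ^ deg i) (gmul deg (gen i) (D (mon m))))"
proof -
  from assms have im: "i \<in> X" "m \<in> mons deg X" using mons_add_msetD[OF assms] by auto
  then have L: "gen i \<in> Lam deg X" "mon m \<in> Lam deg X" by simp_all
  show ?thesis
    unfolding mon_add_mset(3)[OF assms]
    unfolding D_scl[OF gmul_Lam[OF L]] D_gmul[OF L iffD2[OF homog_gen refl]] ..
qed

text \<open>This is the product rule, applied along a monomial. Only products with generators from \<open>Y\<close> occur,
  so \<open>K\<close> may be a subspace that is not an ideal of the whole algebra.\<close>

lemma D_in_ideal:
  assumes "Y \<subseteq> X" "ratvec.subspace K"
    and gen: "\<And>i. i \<in> Y \<Longrightarrow> D (gen i) \<in> K"
    and right: "\<And>p m. p \<in> K \<Longrightarrow> m \<in> mons deg Y \<Longrightarrow> gmul deg p (mon m) \<in> K"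
    and left: "\<And>p i. p \<in> K \<Longrightarrow> i \<in> Y \<Longrightarrow> gmul deg (gen i) p \<in> K"
    and "p \<in> Lam deg Y"
  shows "D p \<in> K"
proof (rule linear_map_on_into[of p "mons deg Y" D K])
  show "p \<in> supp (mons deg Y)" using assms(6) by (simp add: Lam_supp)
  show "linear_map_on (supp (mons deg Y)) D"
  proof (rule linear_map_on_subset[OF D_linear])
    have "mons deg Y \<subseteq> mons deg X" using mons_mset_subset[OF assms(1)] by blast
    then show "supp (mons deg Y) \<subseteq> Lam deg X" unfolding Lam_supp supp_def by blast
  qed
  show "ratvec.subspace K" by fact
  fix m assume "m \<in> mons deg Y"
  then show "D (mon m) \<in> K"
  proof (induction m)
    case empty
    then show ?case using D_gone ratvec.subspace_0[OF assms(2)] by (simp add: gone_mon)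
  next
    case (add i m)
    then have im: "i \<in> Y" "m \<in> mons deg Y" using mons_add_msetD[OF add.prems] by auto
    have "add_mset i m \<in> mons deg X" using add.prems mons_mset_subset[OF assms(1)] by blast
    from D_mon_add_mset[OF this] show ?case
      using im add.IH by (auto intro!: ratvec.subspace_scale[OF assms(2)] ratvec.subspace_add[OF assms(2)]
        right left gen)
  qed
qed

end

section \<open>Ideals generated by generators\<close>

definition meets :: "'i set \<Rightarrow> 'i multiset set" where
  "meets E = {m. set_mset m \<inter> E \<noteq> {}}"

lemma meets_plus: "m + n \<in> meets E \<longleftrightarrow> m \<in> meets E \<or> n \<in> meets E"
  by (auto simp: meets_def)

lemma meets_mono: "E \<subseteq> F \<Longrightarrow> meets E \<subseteq> meets F"
  by (auto simp: meets_def)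

lemma meets_empty [simp]: "meets {} = {}"
  by (simp add: meets_def)

lemma gmul_meets_left: "p \<in> supp (meets E) \<Longrightarrow> gmul deg p q \<in> supp (meets E)"
  by (rule gmul_in_supp[of _ _ q UNIV]) (auto simp: meets_plus)

lemma gmul_meets_right: "q \<in> supp (meets E) \<Longrightarrow> gmul deg p q \<in> supp (meets E)"
  by (rule gmul_in_supp[of p UNIV]) (auto simp: meets_plus)

lemma gen_in_meets: "gen e \<in> supp (meets E) \<longleftrightarrow> e \<in> E"
  by (auto simp: gen_mon meets_def)

text \<open>A monomial that contains a cocycle \<open>e\<close> is a multiple of \<open>e\<close>, and so is its differential.\<close>

lemma (in dga) D_meets:
  assumes "E \<subseteq> X" "\<And>e. e \<in> E \<Longrightarrow> D (gen e) = 0" "p \<in> Lam deg X" "p \<in> supp (meets E)"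
  shows "D p \<in> supp (meets E)"
proof (rule linear_map_on_into[of p "mons deg X \<inter> meets E" D "supp (meets E)"])
  show "p \<in> supp (mons deg X \<inter> meets E)" using assms by (auto simp: Lam_supp simp flip: supp_Int)
  show "linear_map_on (supp (mons deg X \<inter> meets E)) D"
    by (rule linear_map_on_subset[OF D_linear]) (auto simp: Lam_supp simp flip: supp_Int)
  fix m assume m: "m \<in> mons deg X \<inter> meets E"
  then obtain e where "e \<in> E" "e \<in># m" by (auto simp: meets_def)
  then obtain m' where e: "e \<in> E" "m = add_mset e m'" using multi_member_split by metis
  then have "D (mon m) = scl (mono_sign deg {#e#} m') (scl ((-1) ^ deg e) (gmul deg (gen e) (D (mon m'))))"
    using m by (simp add: D_mon_add_mset assms(2))
  then show "D (mon m) \<in> supp (meets E)"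
    using e by (simp add: supp_scl gmul_meets_left gen_in_meets)
qed (rule subspace_supp)

section \<open>Finite-dimensional cohomology\<close>

lemma Lam_homog_supp: "p \<in> Lam deg X \<and> homog deg k p \<longleftrightarrow> p \<in> supp (mons deg X \<inter> {m. mdeg deg m = k})"
  by (auto simp: Lam_supp homog_supp simp flip: supp_Int)

text \<open>The meaning is that the quotient of \<open>Lam deg X\<close> by the ideal generated by \<open>E\<close> has no cohomology
  in degrees \<open>N\<close> and above. Working with representatives avoids forming the quotient algebra.\<close>

definition exact_from :: "('i::linorder \<Rightarrow> nat) \<Rightarrow> 'i set \<Rightarrow> ('i galg \<Rightarrow> 'i galg) \<Rightarrow> 'i set \<Rightarrow> nat \<Rightarrow> bool" where
  "exact_from deg X D E N \<longleftrightarrow> (\<forall>k\<ge>N. \<forall>z\<in>Lam deg X. homog deg k z \<longrightarrow> D z \<in> supp (meets E) \<longrightarrow>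
     (\<exists>y\<in>Lam deg X. homog deg (k - 1) y \<and> z - D y \<in> supp (meets E)))"

text \<open>Only finitely many degrees occur in finitely many representatives, and a homogeneous element
  that is a coboundary up to terms of other degrees is the coboundary of one homogeneous part.\<close>

lemma (in dga) exact_from_finite:
  assumes "finite_dim_cohomology deg X D"
  shows "\<exists>N. exact_from deg X D {} N"
proof -
  from assms obtain S where S: "finite S"
    and ex: "\<And>z. z \<in> Lam deg X \<Longrightarrow> D z = 0 \<Longrightarrow> \<exists>s \<in> ratvec.span S. z - s \<in> D ` Lam deg X"
    unfolding finite_dim_cohomology_def by blast
  define T where "T = mdeg deg ` (\<Union>s\<in>S. keys s)"
  define N where "N = Suc (Max (insert 0 T))"
  have "finite T" using S by (simp add: T_def)
  then have less: "mdeg deg m < N" if "m \<in> (\<Union>s\<in>S. keys s)" for m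
    using that by (auto simp: N_def less_Suc_eq_le T_def intro!: Max_ge)
  have "exact_from deg X D {} N"
    unfolding exact_from_def
  proof (intro allI ballI impI)
    fix k z assume k: "N \<le> k" and z: "z \<in> Lam deg X" "homog deg k z" and "D z \<in> supp (meets {})"
    then have "D z = 0" by (simp add: supp_def)
    with z ex obtain s y where s: "s \<in> ratvec.span S" and y: "y \<in> Lam deg X" "z - s = D y" by blast
    let ?H = "\<lambda>k. restr {m. mdeg deg m = k}"
    have k0: "k > 0" using k by (simp add: N_def)
    have "S \<subseteq> supp {m. mdeg deg m < N}" using less by (auto simp: supp_def)
    then have "s \<in> supp {m. mdeg deg m < N}"
      using s ratvec.span_minimal[OF _ subspace_supp] by blast
    then have "s \<in> supp (- {m. mdeg deg m = k})" by (rule supp_mono[rotated]) (use k in auto)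
    then have s0: "?H k s = 0" by (simp add: restr_zero_iff)
    have zz: "?H k z = z" using z by (simp add: restr_id homog_supp)
    have "?H k (D y) = D (?H (k - 1) y)"
    proof (rule linear_map_on_eq[of y "mons deg X"])
      show "y \<in> supp (mons deg X)" using y by (simp add: Lam_supp)
      show "linear_map_on (supp (mons deg X)) (\<lambda>p. ?H k (D p))"
        by (rule linear_map_on_compose[OF _ linear_restr[of UNIV]]) (use D_linear in \<open>auto simp: Lam_supp\<close>)
      show "linear_map_on (supp (mons deg X)) (\<lambda>p. D (?H (k - 1) p))"
        by (rule linear_map_on_compose[OF linear_restr D_linear]) (auto simp: Lam_supp restr_supp)
      fix m assume m: "m \<in> mons deg X"
      have h: "D (mon m) \<in> supp {n. mdeg deg n = mdeg deg m + 1}"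
        using D_homog[of "mon m" "mdeg deg m"] m by (simp add: homog_supp)
      show "?H k (D (mon m)) = D (?H (k - 1) (mon m))"
      proof (cases "mdeg deg m = k - 1")
        case True
        then have "mdeg deg m + 1 = k" using k0 by simp
        then show ?thesis using h True by (simp add: restr_mon restr_id)
      next
        case False
        then have "D (mon m) \<in> supp (- {n. mdeg deg n = k})"
          using h by (auto elim!: supp_mono[rotated])
        then show ?thesis using False by (simp add: restr_mon D_zero restr_zero_iff)
      qed
    qed
    moreover have "z = ?H k (s + D y)" using y zz by (metis add_diff_cancel_left' diff_add_cancel add.commute)
    ultimately have "z = D (?H (k - 1) y)" by (simp add: restr_add s0)
    moreover have "?H (k - 1) y \<in> Lam deg X" "homog deg (k - 1) (?H (k - 1) y)"
      using y by (simp_all add: Lam_supp restr_supp homog_supp)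
    ultimately show "\<exists>y\<in>Lam deg X. homog deg (k - 1) y \<and> z - D y \<in> supp (meets {})"
      by (metis diff_self zero_in_supp)
  qed
  then show ?thesis ..
qed

lemma mono_sign_even: "even (deg i) \<Longrightarrow> mono_sign deg {#i#} m = 1"
  by (simp add: mono_sign_odds odds_single)

text \<open>An even cocycle generator \<open>e\<close> is regular, so multiplication by \<open>e\<close> gives a long exact sequence
  from which the vanishing of cohomology in high degrees passes to the quotient by \<open>e\<close>.\<close>

lemma (in dga) exact_from_insert:
  assumes N: "exact_from deg X D E N" and E: "insert e E \<subseteq> X" "e \<notin> E"
    and coc: "\<And>i. i \<in> insert e E \<Longrightarrow> D (gen i) = 0" and ev: "even (deg e)"
  shows "exact_from deg X D (insert e E) (N + deg e)"
  unfolding exact_from_def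
proof (intro allI ballI impI)
  fix k z assume k: "N + deg e \<le> k" and z: "z \<in> Lam deg X" "homog deg k z"
    and Dz: "D z \<in> supp (meets (insert e E))"
  \<comment> \<open>Modulo \<open>E\<close>, the differential of \<open>z\<close> is \<open>e w\<close>. As \<open>e\<close> is regular, \<open>w\<close> is a cocycle modulo \<open>E\<close>, hence
    a coboundary \<open>D y1\<close>, and \<open>z - e y1\<close> is a cocycle modulo \<open>E\<close>.\<close>
  define w where "w = lext (\<lambda>m. if e \<in># m \<and> m \<notin> meets E then mon (m - {#e#}) else 0) (D z)"
  have hDz: "homog deg (k + 1) (D z)" and LDz: "D z \<in> Lam deg X"
    using D_homog[OF z(1,2)] D_Lam[OF z(1)] by blast+
  have Dz': "D z \<in> supp (meets (insert e E) \<inter> (mons deg X \<inter> {m. mdeg deg m = k + 1}))"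
    using Dz hDz LDz by (auto simp: Lam_supp homog_supp simp flip: supp_Int)
  have ge: "gmul deg (gen e) (mon m) = mon (add_mset e m)" for m
    by (simp add: gen_mon gmul_mon mono_sign_even ev)
  have w: "w \<in> supp (mons deg X \<inter> {m. mdeg deg m = k + 1 - deg e})"
    unfolding w_def
  proof (rule linear_map_on_into[OF Dz' linear_lext subspace_supp])
    fix m assume "m \<in> meets (insert e E) \<inter> (mons deg X \<inter> {m. mdeg deg m = k + 1})"
    then show "lext (\<lambda>m. if e \<in># m \<and> m \<notin> meets E then mon (m - {#e#}) else 0) (mon m) \<in>
       supp (mons deg X \<inter> {m. mdeg deg m = k + 1 - deg e})"
      by (auto intro: mons_subset[of m] simp: sum_mset_diff image_mset_Diff)
  qed
  have r: "D z - gmul deg (gen e) w \<in> supp (meets E)"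
  proof -
    have "(\<lambda>p. p - gmul deg (gen e) (lext (\<lambda>m. if e \<in># m \<and> m \<notin> meets E then mon (m - {#e#}) else 0) p)) (D z) \<in> supp (meets E)"
    proof (rule linear_map_on_into[OF Dz' _ subspace_supp])
      fix m assume "m \<in> meets (insert e E) \<inter> (mons deg X \<inter> {m. mdeg deg m = k + 1})"
      then have "e \<in># m \<or> m \<in> meets E" by (auto simp: meets_def)
      then show "mon m - gmul deg (gen e) (lext (\<lambda>m. if e \<in># m \<and> m \<notin> meets E then mon (m - {#e#}) else 0) (mon m))
         \<in> supp (meets E)"
        by (auto simp: ge)
    qed (auto simp: linear_map_on_def lext_add lext_scl gmul_add_right gmul_scl_right ratvec.scale_right_diff_distrib)
    then show ?thesis by (simp add: w_def)
  qed
  have wL: "w \<in> Lam deg X" "homog deg (k + 1 - deg e) w" using w Lam_homog_supp by blast+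
  have eL: "gen e \<in> Lam deg X" using E by simp
  have De: "D (gmul deg (gen e) p) = gmul deg (gen e) (D p)" if "p \<in> Lam deg X" for p
    using D_gmul[OF eL that, of "deg e"] coc[of e] ev by simp
  have "D (D z - gmul deg (gen e) w) \<in> supp (meets E)"
    by (rule D_meets[OF _ _ _ r]) (use E coc in \<open>auto intro!: ratvec.subspace_diff[OF subspace_Lam] LDz gmul_Lam eL wL\<close>)
  also have "D (D z - gmul deg (gen e) w) = 0 - gmul deg (gen e) (D w)"
    by (simp only: D_diff[OF LDz gmul_Lam[OF eL wL(1)]] De[OF wL(1)] D_D[OF z(1)])
  finally have "gmul deg (gen e) (D w) \<in> supp (meets E)"
    using supp_diff[of 0] by (metis diff_0 minus_minus zero_in_supp)
  moreover have "gmul deg (gen e) p \<in> supp (meets E) \<Longrightarrow> p \<in> supp (meets E)" for p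
  proof -
    assume a: "gmul deg (gen e) p \<in> supp (meets E)"
    have l: "lookup (gmul deg (gen e) p) (add_mset e m) = lookup p m" for m
    proof (rule supp_induct[of p UNIV])
      show "lookup (gmul deg (gen e) (mon n)) (add_mset e m) = lookup (mon n) m" for n
        by (simp add: ge lookup_single when_def)
    qed (auto simp: gmul_add_right gmul_scl_right lookup_add lookup_scl)
    show "p \<in> supp (meets E)"
      unfolding supp_iff
    proof (intro allI impI)
      fix m assume "m \<notin> meets E"
      then have "add_mset e m \<notin> meets E" using E by (auto simp: meets_def)
      with a l[of m] show "lookup p m = 0" by (simp add: supp_iff)
    qed
  qed
  ultimately have "D w \<in> supp (meets E)" by blast
  moreover have "k + 1 - deg e \<ge> N" using k by simp
  ultimately obtain y1 where y1: "y1 \<in> Lam deg X" "homog deg (k + 1 - deg e - 1) y1" "w - D y1 \<in> supp (meets E)"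
    using N wL unfolding exact_from_def by blast
  define z1 where "z1 = z - gmul deg (gen e) y1"
  have "homog deg (deg e + (k + 1 - deg e - 1)) (gmul deg (gen e) y1)"
    using y1(2) by (intro gmul_homog) auto
  moreover have "deg e + (k + 1 - deg e - 1) = k" using k by simp
  ultimately have h1: "homog deg k (gmul deg (gen e) y1)" by simp
  have z1: "z1 \<in> Lam deg X" "homog deg k z1"
    using z h1 by (auto simp: z1_def homog_supp intro!: ratvec.subspace_diff[OF subspace_Lam] gmul_Lam eL y1 supp_diff)
  have "D z1 = (D z - gmul deg (gen e) w) + gmul deg (gen e) (w - D y1)"
    by (simp add: z1_def D_diff[OF z(1) gmul_Lam[OF eL y1(1)]] De[OF y1(1)] gmul_diff_right)
  also have "\<dots> \<in> supp (meets E)"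
    by (intro supp_add r gmul_meets_right y1)
  finally obtain y2 where y2: "y2 \<in> Lam deg X" "homog deg (k - 1) y2" "z1 - D y2 \<in> supp (meets E)"
    using N z1 k unfolding exact_from_def by (metis add_leD1)
  have "z - D y2 = (z1 - D y2) + gmul deg (gen e) y1" by (simp add: z1_def)
  also have "\<dots> \<in> supp (meets (insert e E))"
    by (intro supp_add gmul_meets_left) (auto simp: gen_in_meets intro: supp_mono[OF meets_mono y2(3)])
  finally show "\<exists>y\<in>Lam deg X. homog deg (k - 1) y \<and> z - D y \<in> supp (meets (insert e E))"
    using y2 by blast
qed

lemma (in dga) exact_from_even_cocycles:
  assumes "finite_dim_cohomology deg X D" "finite E" "E \<subseteq> X"
    and "\<And>e. e \<in> E \<Longrightarrow> even (deg e) \<and> D (gen e) = 0"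
  shows "\<exists>N. exact_from deg X D E N"
  using assms(2,3,4)
proof (induction E rule: finite_induct)
  case empty
  then show ?case using exact_from_finite[OF assms(1)] by simp
next
  case (insert e E)
  then obtain N where "exact_from deg X D E N" by auto
  from exact_from_insert[OF this, of e] insert show ?case by (auto intro!: exI)
qed


section \<open>Quadratic two-stage models\<close>

lemma size_2_mset:
  assumes "size m = 2"
  obtains a b where "m = {#a, b#}"
proof -
  from assms obtain a n where m: "m = add_mset a n"
    using size_eq_Suc_imp_eq_union[of m 1] by (auto simp: numeral_2_eq_2)
  with assms have "size n = 1" by simp
  then obtain b where "n = {#b#}" using size_1_singleton_mset by blast
  with m that show thesis by blast
qed

lemma lin_gen: "i \<in> X \<Longrightarrow> gen i \<in> lin X"
  by (simp add: lin_def ratvec.span_base)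

locale quad_model = dga deg "U \<union> V" d
  for deg :: "'i::linorder \<Rightarrow> nat" and U V :: "'i set" and d :: "'i galg \<Rightarrow> 'i galg" +
  assumes disjoint: "U \<inter> V = {}"
    and finite_U: "finite U" and finite_V: "finite V"
    and deg_ge_2: "i \<in> U \<union> V \<Longrightarrow> 2 \<le> deg i"
    and dU: "u \<in> U \<Longrightarrow> d (gen u) = 0"
    and dV: "v \<in> V \<Longrightarrow> d (gen v) \<in> supp {m \<in> mons deg U. size m = 2}"
    and finite_cohomology: "finite_dim_cohomology deg (U \<union> V) d"
begin

text \<open>Suppose that \<open>y \<in> V\<close> is even. In the quotient by the even generators of \<open>U\<close> the element \<open>y\<close> is
  a cocycle, because a quadratic element of odd degree is a sum of products of an even and an odd
  generator. That quotient still has no cohomology in high degrees, so a power of \<open>y\<close> is a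
  coboundary in it. But every coboundary lies in the ideal generated by \<open>U\<close>, and no power of \<open>y\<close> does.\<close>

lemma V_odd:
  assumes y: "y \<in> V"
  shows "odd (deg y)"
proof
  assume ev: "even (deg y)"
  define E where "E = even_part deg U"
  have "\<exists>N. exact_from deg (U \<union> V) d E N"
    by (rule exact_from_even_cocycles[OF finite_cohomology])
       (use finite_U in \<open>auto simp: E_def even_part_def dU\<close>)
  then obtain N where N: "exact_from deg (U \<union> V) d E N" ..
  have dy: "d (gen y) \<in> supp (meets E)"
  proof -
    have "m \<in> meets E" if m: "m \<in> mons deg U" "size m = 2" "mdeg deg m = deg y + 1" for m
    proof -
      obtain a b where "m = {#a, b#}" using m(2) by (rule size_2_mset)
      moreover from this have "deg a + deg b = deg y + 1" using m(3) by simp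
      then have "even (deg a) \<or> even (deg b)" using ev by presburger
      ultimately show ?thesis using m(1) by (auto simp: meets_def E_def even_part_def mons_def)
    qed
    moreover have "homog deg (deg y + 1) (d (gen y))"
      using y by (intro D_homog) auto
    ultimately show ?thesis
      using dV[OF y] by (auto simp: supp_def homog_supp)
  qed
  define m where "m = (\<lambda>k. replicate_mset k y)"
  have m: "m k \<in> mons deg (U \<union> V)" for k
    using y ev by (auto simp: m_def mons_def)
  have dm: "d (mon (m k)) \<in> supp (meets E)" for k
  proof (induction k)
    case 0
    then show ?case using D_gone by (simp add: m_def gone_mon)
  next
    case (Suc k)
    have "add_mset y (m k) \<in> mons deg (U \<union> V)" using m[of "Suc k"] by (simp add: m_def)
    from D_mon_add_mset[OF this] show ?case
      using Suc dy by (simp add: m_def supp_scl supp_add gmul_meets_left gmul_meets_right)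
  qed
  have "mdeg deg (m N) \<ge> N"
    using deg_ge_2[of y] y by (simp add: m_def)
  then obtain \<Psi> where \<Psi>: "\<Psi> \<in> Lam deg (U \<union> V)" "mon (m N) - d \<Psi> \<in> supp (meets E)"
    using N m dm unfolding exact_from_def by (metis homog_mon mon_in_Lam)
  have "d \<Psi> \<in> supp (meets U)"
  proof (rule D_in_ideal[OF subset_refl subspace_supp _ gmul_meets_left gmul_meets_right \<Psi>(1)])
    fix i assume "i \<in> U \<union> V"
    moreover have "{m \<in> mons deg U. size m = 2} \<subseteq> meets U"
      by (auto simp: mons_def meets_def inf.absorb1)
    ultimately show "d (gen i) \<in> supp (meets U)"
      using dU dV supp_mono by (metis UnE zero_in_supp)
  qed
  then have "(mon (m N) - d \<Psi>) + d \<Psi> \<in> supp (meets U)"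
    using \<Psi>(2) by (intro supp_add) (auto elim!: supp_mono[rotated] simp: meets_def E_def even_part_def)
  then have "m N \<in> meets U" by simp
  then show False using disjoint y by (auto simp: m_def meets_def split: if_splits)
qed

end

section \<open>The part of a differential without odd generators\<close>

definition over :: "'i set \<Rightarrow> 'i multiset set" where
  "over Q = {m. set_mset m \<subseteq> Q}"

lemma over_plus [simp]: "m + n \<in> over Q \<longleftrightarrow> m \<in> over Q \<and> n \<in> over Q"
  by (auto simp: over_def)

lemma over_add_mset [simp]: "add_mset i m \<in> over Q \<longleftrightarrow> i \<in> Q \<and> m \<in> over Q"
  by (auto simp: over_def)

lemma over_empty [simp]: "{#} \<in> over Q"
  by (simp add: over_def)

lemma scl_mult_left: "scl c p * q = scl c (p * q)" for p q :: "'i galg"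
  by (simp add: scl_def mult_map_scale_conv_mult mult.assoc)

lemma scl_mult_right: "p * scl c q = scl c (p * q)" for p q :: "'i galg"
  by (simp add: scl_def mult_map_scale_conv_mult mult.assoc mult.left_commute)

lemma mon_mult: "mon m * mon n = mon (m + n)"
  by (simp add: mult_single)

lemma linear_times_left: "linear_map_on S f \<Longrightarrow> linear_map_on S (\<lambda>p. f p * q)" for q :: "'i galg"
  by (simp add: linear_map_on_def scl_mult_left distrib_right)

lemma linear_times_right: "linear_map_on S f \<Longrightarrow> linear_map_on S (\<lambda>p. q * f p)" for q :: "'i galg"
  by (simp add: linear_map_on_def scl_mult_right distrib_left)

lemma linear_plus: "linear_map_on S f \<Longrightarrow> linear_map_on S g \<Longrightarrow> linear_map_on S (\<lambda>p. f p + g p)"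
  by (simp add: linear_map_on_def ratvec.scale_right_distrib algebra_simps)

lemma bilinear_eq:
  assumes "\<And>m n. f (mon m) (mon n) = g (mon m) (mon n)"
    and "\<And>p. linear_map_on UNIV (f p)" "\<And>q. linear_map_on UNIV (\<lambda>p. f p q)"
    and "\<And>p. linear_map_on UNIV (g p)" "\<And>q. linear_map_on UNIV (\<lambda>p. g p q)"
  shows "f p q = g p q"
proof -
  have 1: "f (mon m) q = g (mon m) q" for m q
    by (rule linear_map_on_eq[of q UNIV]) (simp_all add: assms)
  show ?thesis
    by (rule linear_map_on_eq[of p UNIV "\<lambda>p. f p q" "\<lambda>p. g p q"]) (simp_all add: assms 1)
qed

text \<open>The coefficient of the generator \<open>u\<close> in the terms that contain \<open>u\<close> once and otherwise only
  generators in \<open>Q\<close>. When the elements of \<open>Q\<close> are even and \<open>u\<close> is not in \<open>Q\<close>, it needs no sign.\<close>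

definition tau :: "'i set \<Rightarrow> 'i \<Rightarrow> 'i galg \<Rightarrow> 'i galg" where
  "tau Q u = lext (\<lambda>m. if u \<in># m \<and> m - {#u#} \<in> over Q then mon (m - {#u#}) else 0)"

lemma linear_tau: "linear_map_on S (tau Q u)"
  unfolding tau_def by (rule linear_lext)

lemma tau_mon: "tau Q u (mon m) = (if u \<in># m \<and> m - {#u#} \<in> over Q then mon (m - {#u#}) else 0)"
  by (simp add: tau_def)

lemma tau_add: "tau Q u (p + q) = tau Q u p + tau Q u q"
  and tau_scl: "tau Q u (scl c p) = scl c (tau Q u p)"
  and tau_zero [simp]: "tau Q u 0 = 0"
  and tau_sum: "tau Q u (\<Sum>i\<in>I. f i) = (\<Sum>i\<in>I. tau Q u (f i))"
  by (simp_all add: tau_def lext_add lext_scl lext_zero lext_sum)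

locale even_gens =
  fixes deg :: "'i::linorder \<Rightarrow> nat" and Q :: "'i set"
  assumes even_Q: "q \<in> Q \<Longrightarrow> even (deg q)"
begin

lemma odds_over: "m \<in> over Q \<Longrightarrow> odds deg m = {}"
  using even_Q by (auto simp: over_def odds_def)

lemma mdeg_over: "m \<in> over Q \<Longrightarrow> even (mdeg deg m)"
  by (induction m) (auto simp: even_Q)

lemma over_mons: "m \<in> over Q \<Longrightarrow> Q \<subseteq> X \<Longrightarrow> m \<in> mons deg X"
  using even_Q by (auto simp: over_def mons_def) (metis count_eq_zero_iff le_zero_eq nle_le subsetD)

lemma restr_gmul: "restr (over Q) (gmul deg p q) = restr (over Q) p * restr (over Q) q"
proof (rule bilinear_eq[where f = "\<lambda>p q. restr (over Q) (gmul deg p q)"])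
  show "restr (over Q) (gmul deg (mon m) (mon n)) = restr (over Q) (mon m) * restr (over Q) (mon n)" for m n
    by (auto simp: gmul_mon restr_scl restr_mon mon_mult mono_sign_odds odds_over)
qed (intro linear_map_on_compose[OF linear_gmul_right linear_restr[of UNIV]] UNIV_I
    linear_map_on_compose[OF linear_gmul_left linear_restr[of UNIV]] linear_times_left linear_times_right linear_restr)+

text \<open>A product of even generators has even degree.\<close>

lemma restr_odd:
  assumes "homog deg k p" "odd k"
  shows "restr (over Q) p = 0"
  using assms by (auto simp: restr_zero_iff homog_supp dest: mdeg_over elim!: supp_mono[rotated])

text \<open>Dropping the terms with two or more odd generators makes the algebra commutative, which is why
  this product rule has no signs.\<close>

lemma tau_gmul:
  assumes u: "u \<notin> Q"
  shows "tau Q u (gmul deg p q) = tau Q u p * restr (over Q) q + restr (over Q) p * tau Q u q"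
proof (rule bilinear_eq[where f = "\<lambda>p q. tau Q u (gmul deg p q)"
      and g = "\<lambda>p q. tau Q u p * restr (over Q) q + restr (over Q) p * tau Q u q"])
  fix m n
  have nu: "m \<in> over Q \<Longrightarrow> u \<notin># m" for m using u by (auto simp: over_def)
  consider (l) m' where "m = add_mset u m'" "m' \<in> over Q" "n \<in> over Q"
    | (r) n' where "n = add_mset u n'" "n' \<in> over Q" "m \<in> over Q"
    | (z) "\<not> (u \<in># m \<and> m - {#u#} \<in> over Q \<and> n \<in> over Q)" "\<not> (u \<in># n \<and> n - {#u#} \<in> over Q \<and> m \<in> over Q)"
    by (metis insert_DiffM)
  then show "tau Q u (gmul deg (mon m) (mon n))
     = tau Q u (mon m) * restr (over Q) (mon n) + restr (over Q) (mon m) * tau Q u (mon n)"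
  proof cases
    case l
    then show ?thesis using nu[OF l(3)] u
      by (simp add: gmul_mon tau_scl tau_mon restr_mon mono_sign_odds odds_over mon_mult)
  next
    case r
    then show ?thesis using nu[OF r(3)] u
      by (simp add: gmul_mon tau_scl tau_mon restr_mon mono_sign_odds odds_over mon_mult)
  next
    case z
    have "\<not> (u \<in># m + n \<and> m + n - {#u#} \<in> over Q)"
    proof
      assume a: "u \<in># m + n \<and> m + n - {#u#} \<in> over Q"
      then consider "u \<in># m" | "u \<in># n" by auto
      then show False
      proof cases
        case 1
        then have "m + n - {#u#} = (m - {#u#}) + n" by simp
        then show False using z a 1 by (metis over_plus)
      next
        case 2
        then have "m + n - {#u#} = m + (n - {#u#})" by simp
        then show False using z a 2 by (metis over_plus)
      qed
    qed
    then have 0: "tau Q u (gmul deg (mon m) (mon n)) = 0" by (auto simp: gmul_mon tau_scl tau_mon)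
    show ?thesis unfolding 0 using z by (auto simp: tau_mon restr_mon)
  qed
qed (intro linear_map_on_compose[OF linear_gmul_right linear_tau[of UNIV]] UNIV_I
    linear_map_on_compose[OF linear_gmul_left linear_tau[of UNIV]] linear_times_left linear_times_right
    linear_restr linear_plus linear_tau)+

end

text \<open>On even generators the graded product is the commutative product \<open>*\<close>, which is used here.\<close>

definition poly_ideal :: "'i set \<Rightarrow> 'i galg set \<Rightarrow> 'i galg set" where
  "poly_ideal Q F = ratvec.span {mon m * f | m f. m \<in> over Q \<and> f \<in> F}"

lemma subspace_poly_ideal: "ratvec.subspace (poly_ideal Q F)"
  by (simp add: poly_ideal_def)

lemma poly_ideal_mult:
  assumes "p \<in> supp (over Q)" "f \<in> poly_ideal Q F"
  shows "p * f \<in> poly_ideal Q F"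
proof (rule linear_map_on_into[OF assms(1) _ subspace_poly_ideal])
  show "linear_map_on (supp (over Q)) (\<lambda>p. p * f)"
    by (simp add: linear_map_on_def distrib_right scl_mult_left)
  fix m assume m: "m \<in> over Q"
  show "mon m * f \<in> poly_ideal Q F"
    using assms(2) unfolding poly_ideal_def
  proof (induction rule: ratvec.span_induct_alt)
    case base
    then show ?case by (simp add: ratvec.span_zero)
  next
    case (step c x y)
    then obtain n g where x: "x = mon n * g" "n \<in> over Q" "g \<in> F" by auto
    have "mon m * x \<in> {mon m * f |m f. m \<in> over Q \<and> f \<in> F}"
      using x m by (auto simp: mult.assoc[symmetric] mon_mult intro!: exI[of _ "m + n"] exI[of _ g])
    then show ?case
      using step by (simp add: distrib_left scl_mult_right ratvec.span_add ratvec.span_scale ratvec.span_base)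
  qed
qed

lemma poly_ideal_base: "f \<in> F \<Longrightarrow> f \<in> poly_ideal Q F"
  unfolding poly_ideal_def
  by (rule ratvec.span_base) (auto intro!: exI[of _ "{#}"] simp: single_one)

lemmas poly_ideal_add = ratvec.subspace_add[OF subspace_poly_ideal]
lemmas poly_ideal_scl = ratvec.subspace_scale[OF subspace_poly_ideal]
lemmas poly_ideal_diff = ratvec.subspace_diff[OF subspace_poly_ideal]
lemmas poly_ideal_sum = ratvec.subspace_sum[OF subspace_poly_ideal]
lemmas poly_ideal_zero = ratvec.subspace_0[OF subspace_poly_ideal]

locale dga_even = dga deg X D + even_gens deg Q
  for deg :: "'i::linorder \<Rightarrow> nat" and X D and Q :: "'i set"
begin

abbreviation sigma :: "'i galg \<Rightarrow> 'i galg" where "sigma \<equiv> restr (over Q)"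

text \<open>The elements whose part without odd generators lies in a given ideal form an ideal of the
  free algebra.\<close>

lemma sigma_D_in_ideal:
  assumes "\<And>i. i \<in> X \<Longrightarrow> sigma (D (gen i)) \<in> poly_ideal Q F" "p \<in> Lam deg X"
  shows "sigma (D p) \<in> poly_ideal Q F"
proof -
  have "D p \<in> {x. sigma x \<in> poly_ideal Q F}"
  proof (rule D_in_ideal[OF subset_refl])
    show "ratvec.subspace {x. sigma x \<in> poly_ideal Q F}"
      by (rule ratvec.subspaceI) (auto simp: restr_add restr_scl poly_ideal_zero poly_ideal_add poly_ideal_scl)
  qed (use assms in \<open>auto simp: restr_gmul intro: poly_ideal_mult\<close>,
      metis mult.commute poly_ideal_mult restr_in_supp)
  then show ?thesis by simp
qed

lemma sigma_D_even:
  assumes "i \<in> X" "even (deg i)"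
  shows "sigma (D (gen i)) = 0"
  by (rule restr_odd[OF D_homog[of "gen i" "deg i"]]) (use assms in auto)

text \<open>Here \<open>tau\<close> alone does not have an ideal as kernel, but the common kernel of \<open>tau\<close> and \<open>sigma\<close>
  absorbs products with generators from \<open>Y\<close>.\<close>

lemma tau_D_over:
  assumes u: "u \<notin> Q" and Y: "Y \<subseteq> Q" "Q \<subseteq> X" and 0: "\<And>q. q \<in> Y \<Longrightarrow> tau Q u (D (gen q)) = 0"
    and m: "m \<in> over Y"
  shows "tau Q u (D (mon m)) = 0"
proof -
  have "D (mon m) \<in> {x. tau Q u x = 0 \<and> sigma x = 0}"
  proof (rule D_in_ideal[of Y])
    show "ratvec.subspace {x. tau Q u x = 0 \<and> sigma x = 0}"
      by (rule ratvec.subspaceI) (auto simp: restr_add restr_scl tau_add tau_scl)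
    have "m \<in> over Y \<Longrightarrow> m \<in> mons deg Y" for m
      using even_Q Y by (auto simp: over_def mons_def) (metis count_eq_zero_iff le_zero_eq nle_le subsetD)
    then show "mon m \<in> Lam deg Y" using m by simp
  next
    fix i assume "i \<in> Y"
    then show "D (gen i) \<in> {x. tau Q u x = 0 \<and> sigma x = 0}"
      using Y 0 sigma_D_even[of i] even_Q[of i] by blast
  qed (use Y in \<open>auto simp: restr_gmul tau_gmul[OF u]\<close>)
  then show ?thesis by simp
qed

text \<open>A product of at least two odd generators loses one of them under \<open>tau \<circ> D\<close>, and only
  through the even part of its differential. If \<open>p\<close> is not the generator \<open>u\<close> that has to survive,
  then \<open>p\<close> is the one that is differentiated.\<close>

lemma tau_D_odd:
  assumes u: "u \<notin> Q" and m: "add_mset p m \<in> mons deg X" and p: "p \<noteq> u" "p \<notin> Q" and "m \<notin> over Q"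
  shows "tau Q u (D (mon (add_mset p m))) = scl (mono_sign deg {#p#} m) (sigma (D (gen p)) * tau Q u (mon m))"
proof -
  have "sigma (mon m) = 0" "sigma (gen p) = 0" "tau Q u (gen p) = 0"
    using assms by (auto simp: restr_mon gen_mon tau_mon)
  then show ?thesis
    by (simp add: D_mon_add_mset[OF m] tau_scl tau_add tau_gmul[OF u])
qed

end


section \<open>Counting monomials modulo an ideal\<close>

lemma independent_mon: "ratvec.independent (mon ` M)"
  unfolding ratvec.dependent_def
proof
  assume "\<exists>a\<in>mon ` M. a \<in> ratvec.span (mon ` M - {a})"
  then obtain m where m: "mon m \<in> ratvec.span (mon ` M - {mon m})" by blast
  have "mon ` M - {mon m} \<subseteq> supp (M - {m})" by auto
  from ratvec.span_minimal[OF this subspace_supp] m have "mon m \<in> supp (M - {m})" by blast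
  then show False by simp
qed

lemma inj_mon: "inj_on mon M"
  by (rule inj_onI) (metis insertI1 lookup_single_eq lookup_single_not_eq zero_neq_one)

lemma dim_lin: "ratvec.dim (lin X) = card X"
proof -
  have gen: "gen = (\<lambda>i. mon {#i#})" by (simp add: fun_eq_iff gen_mon)
  have "gen ` X = mon ` ((\<lambda>i. {#i#}) ` X)" by (simp add: gen image_image)
  then have "ratvec.dim (lin X) = card (gen ` X)"
    unfolding lin_def by (metis independent_mon ratvec.dim_span_eq_card_independent)
  also have "\<dots> = card X"
    by (rule card_image) (auto simp: inj_on_def gen dest: inj_onD[OF inj_mon])
  finally show ?thesis .
qed

lemma times_in_supp:
  assumes "p \<in> supp M" "q \<in> supp N" "\<And>m n. m \<in> M \<Longrightarrow> n \<in> N \<Longrightarrow> m + n \<in> K"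
  shows "p * q \<in> supp K"
  using assms keys_mult[of p q] by (fastforce simp: supp_def)

definition bounded :: "'i set \<Rightarrow> nat \<Rightarrow> 'i multiset set" where
  "bounded Q N = {m \<in> over Q. \<forall>q. count m q < N}"

lemma finite_bounded:
  assumes "finite Q"
  shows "finite (bounded Q N)"
proof (rule finite_imageD)
  show "inj_on count (bounded Q N)" by (auto simp: inj_on_def count_inject)
  have "count ` bounded Q N \<subseteq> {f. \<forall>x. (x \<in> Q \<longrightarrow> f x \<in> {..<N}) \<and> (x \<notin> Q \<longrightarrow> f x = 0)}"
    by (auto simp: bounded_def over_def not_in_iff[symmetric])
  then show "finite (count ` bounded Q N)"
    by (rule finite_subset) (intro finite_set_of_finite_funs assms finite_lessThan)
qed

lemma split_power:
  assumes "N \<le> count m q"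
  obtains n where "m = replicate_mset N q + n"
  using assms by (metis count_le_replicate_mset_subset_eq subset_mset.le_iff_add)

lemma size_filter_le_mdeg:
  assumes "\<And>q. q \<in> Q \<Longrightarrow> 0 < deg q" "m \<in> over Q"
  shows "size (filter_mset P m) \<le> mdeg deg m"
  using assms(2)
proof (induction m)
  case (add x m)
  then show ?case using assms(1)[of x] by auto
qed simp

text \<open>Replacing a high power of \<open>q\<close> preserves the degree and increases the number of factors from
  \<open>A\<close>. That number is bounded by the degree, so the rewriting stops.\<close>

lemma congruent_bounded:
  fixes deg :: "'i \<Rightarrow> nat"
  assumes pos: "\<And>q. q \<in> Q \<Longrightarrow> 0 < deg q" and A: "A \<subseteq> Q" and "0 < N"
    and nilA: "\<And>a. a \<in> A \<Longrightarrow> mon (replicate_mset N a) \<in> poly_ideal Q F"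
    and nilQ: "\<And>q. q \<in> Q - A \<Longrightarrow>
      \<exists>r \<in> supp (over Q \<inter> meets A \<inter> {m. mdeg deg m = N * deg q}). mon (replicate_mset N q) - r \<in> poly_ideal Q F"
    and mQ: "m \<in> over Q"
  shows "\<exists>b \<in> supp (bounded Q N). mon m - b \<in> poly_ideal Q F"
  using mQ
proof (induction "mdeg deg m - size (filter_mset (\<lambda>x. x \<in> A) m)" arbitrary: m rule: less_induct)
  case less
  let ?a = "\<lambda>m. size (filter_mset (\<lambda>x. x \<in> A) m)"
  let ?S = "{x. \<exists>b \<in> supp (bounded Q N). x - b \<in> poly_ideal Q F}"
  have S: "ratvec.subspace ?S"
  proof (rule ratvec.subspaceI)
    show "0 \<in> ?S" by (intro CollectI bexI[of _ 0]) (simp_all add: poly_ideal_zero)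
    fix x y assume "x \<in> ?S" "y \<in> ?S"
    then obtain b c where "b \<in> supp (bounded Q N)" "x - b \<in> poly_ideal Q F"
      "c \<in> supp (bounded Q N)" "y - c \<in> poly_ideal Q F" by blast
    then show "x + y \<in> ?S"
      using poly_ideal_add[of "x - b" Q F "y - c"]
      by (auto intro!: bexI[of _ "b + c"] supp_add simp: algebra_simps)
  next
    fix c x assume "x \<in> ?S"
    then obtain b where b: "b \<in> supp (bounded Q N)" "x - b \<in> poly_ideal Q F" by blast
    then have "scl c x - scl c b \<in> poly_ideal Q F"
      using poly_ideal_scl[of "x - b" Q F c] by (simp add: ratvec.scale_right_diff_distrib)
    then show "scl c x \<in> ?S" using b supp_scl by blast
  qed
  have JS: "x \<in> ?S" if "x \<in> poly_ideal Q F" for x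
    using that by (auto intro!: bexI[of _ 0])
  consider (a) a where "a \<in> A" "N \<le> count m a" | (q) q where "q \<in> Q - A" "N \<le> count m q" | (b) "m \<in> bounded Q N"
  proof -
    have "m \<in> bounded Q N \<or> (\<exists>q\<in>Q. N \<le> count m q)"
    proof (rule disjCI)
      assume "\<not> (\<exists>q\<in>Q. N \<le> count m q)"
      then have "count m q < N" for q
        using less.prems \<open>0 < N\<close> not_in_iff[of q m] by (cases "q \<in> Q") (auto simp: over_def not_le)
      then show "m \<in> bounded Q N" using less.prems by (simp add: bounded_def)
    qed
    then show thesis using that A by blast
  qed
  then have "mon m \<in> ?S"
  proof cases
    case a
    obtain n where n: "m = replicate_mset N a + n" using split_power[OF a(2)] by blast
    then have "mon m = mon n * mon (replicate_mset N a)" by (simp add: mon_mult add.commute)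
    then have "mon m \<in> poly_ideal Q F"
      using less.prems n nilA[OF a(1)] by (simp add: poly_ideal_mult)
    then show ?thesis by (rule JS)
  next
    case q
    obtain n where n: "m = replicate_mset N q + n" using split_power[OF q(2)] by blast
    obtain r where r: "r \<in> supp (over Q \<inter> meets A \<inter> {m. mdeg deg m = N * deg q})"
      "mon (replicate_mset N q) - r \<in> poly_ideal Q F" using nilQ q by blast
    have nQ: "n \<in> over Q" using less.prems n by simp
    have "mon n * r \<in> ?S"
    proof (rule linear_map_on_into[OF r(1) _ S])
      show "linear_map_on (supp (over Q \<inter> meets A \<inter> {m. mdeg deg m = N * deg q})) (\<lambda>r. mon n * r)"
        by (simp add: linear_map_on_def distrib_left scl_mult_right)
      fix k assume k: "k \<in> over Q \<inter> meets A \<inter> {m. mdeg deg m = N * deg q}"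
      then obtain a where "a \<in> A" "a \<in># k" by (auto simp: meets_def)
      then have "a \<in># filter_mset (\<lambda>x. x \<in> A) k" by simp
      then have "?a k > 0" by (metis empty_iff gr0I set_mset_empty size_eq_0_iff_empty)
      moreover have a0: "filter_mset (\<lambda>x. x \<in> A) (replicate_mset N q) = {#}" using q by (induction N) auto
      moreover have "mdeg deg (replicate_mset N q) = N * deg q" by simp
      moreover have "?a (n + k) \<le> mdeg deg (n + k)"
        by (rule size_filter_le_mdeg[OF pos]) (use k nQ in auto)
      ultimately have "mdeg deg (n + k) - ?a (n + k) < mdeg deg m - ?a m"
        using k by (simp add: n a0)
      from less.hyps[OF this] have "mon (n + k) \<in> ?S" using k nQ by simp
      then show "mon n * mon k \<in> ?S" by (simp add: mon_mult)
    qed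
    moreover have "mon n * (mon (replicate_mset N q) - r) \<in> ?S"
      by (intro JS poly_ideal_mult r) (simp add: nQ)
    ultimately have "mon n * (mon (replicate_mset N q) - r) + mon n * r \<in> ?S"
      by (intro ratvec.subspace_add[OF S])
    then show ?thesis by (simp add: n algebra_simps mon_mult)
  next
    case b
    then show ?thesis using poly_ideal_zero by (auto intro!: bexI[of _ "mon m"])
  qed
  then show ?case by simp
qed

lemma sum_le_add_one: "finite V \<Longrightarrow> v \<in> V \<Longrightarrow> sum (a(v := Suc (a v))) V = Suc (sum a V)" for a :: "'v \<Rightarrow> nat"
  by (simp add: sum.remove)

text \<open>Iterating the reduction modulo the ideal writes a monomial as a polynomial in the \<open>f v\<close> with
  coefficients spanned by \<open>B\<close>. Each \<open>f v\<close> that is split off lowers the degree, which bounds the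
  exponents by the degree \<open>t\<close>.\<close>

lemma monomials_in_span:
  fixes deg :: "'i \<Rightarrow> nat" and f :: "'v \<Rightarrow> 'i galg"
  assumes V: "finite V" and f: "\<And>v. v \<in> V \<Longrightarrow> f v \<in> supp (over Q \<inter> {m. mdeg deg m = e v})"
    and e: "\<And>v. v \<in> V \<Longrightarrow> 0 < e v"
    and B: "B \<subseteq> over Q"
    and red: "\<And>m. m \<in> over Q \<Longrightarrow> \<exists>b \<in> supp B. mon m - b \<in> poly_ideal Q (f ` V)"
    and "m \<in> over Q" "mdeg deg m \<le> t"
  shows "mon m \<in> ratvec.span {mon b * (\<Prod>v\<in>V. f v ^ \<alpha> v) | b \<alpha>. b \<in> B \<and> sum \<alpha> V \<le> t}"
  using assms(6,7)
proof (induction t arbitrary: m rule: less_induct)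
  case (less t)
  let ?G = "\<lambda>t. {mon b * (\<Prod>v\<in>V. f v ^ \<alpha> v) | b \<alpha>. b \<in> B \<and> sum \<alpha> V \<le> t}"
  define k where "k = mdeg deg m"
  have kt: "k \<le> t" using less.prems by (simp add: k_def)
  let ?H = "restr {m. mdeg deg m = k}"
  obtain b where b: "b \<in> supp B" "mon m - b \<in> poly_ideal Q (f ` V)" using red less.prems by blast
  have "mon m = ?H (b + (mon m - b))" by (simp add: restr_mon k_def)
  also have "\<dots> = ?H b + ?H (mon m - b)" by (rule restr_add)
  also have "\<dots> \<in> ratvec.span (?G t)"
  proof (rule ratvec.span_add)
    have "?H b \<in> supp B" using b by (simp add: restr_supp)
    then show "?H b \<in> ratvec.span (?G t)"
    proof (rule supp_in_subspace[OF _ ratvec.subspace_span])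
      fix n assume "n \<in> B"
      then have "mon n * (\<Prod>v\<in>V. f v ^ 0) \<in> ?G t" by (intro CollectI exI[of _ n] exI[of _ "\<lambda>_. 0"]) simp
      then show "mon n \<in> ratvec.span (?G t)" by (intro ratvec.span_base) simp
    qed
    from b(2) show "?H (mon m - b) \<in> ratvec.span (?G t)"
      unfolding poly_ideal_def
    proof (induction rule: ratvec.span_induct_alt)
      case base
      then show ?case by (simp add: ratvec.span_zero)
    next
      case (step c x y)
      then obtain n v where x: "x = mon n * f v" "n \<in> over Q" "v \<in> V" by auto
      have xs: "x \<in> supp {l. mdeg deg l = mdeg deg n + e v}"
        unfolding x by (rule times_in_supp[OF _ f[OF x(3)], of _ "{n}"]) auto
      have "?H x \<in> ratvec.span (?G t)"
      proof (cases "mdeg deg n + e v = k")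
        case True
        then have "?H x = x" using xs by (simp add: restr_id)
        moreover have "x \<in> ratvec.span (?G t)"
        proof -
          have lt: "k - e v < t" "mdeg deg n \<le> k - e v" using True e[OF x(3)] kt by auto
          from less.IH[OF lt(1) x(2) lt(2)] have "mon n \<in> ratvec.span (?G (k - e v))" .
          then show ?thesis unfolding x
          proof (induction rule: ratvec.span_induct_alt)
            case base
            then show ?case by (simp add: ratvec.span_zero)
          next
            case (step c y z)
            then obtain b \<alpha> where y: "y = mon b * (\<Prod>v\<in>V. f v ^ \<alpha> v)" "b \<in> B" "sum \<alpha> V \<le> k - e v" by auto
            have "(\<Prod>w\<in>V. f w ^ (\<alpha>(v := Suc (\<alpha> v))) w) = f v * (\<Prod>w\<in>V. f w ^ \<alpha> w)"
              using V x(3) by (simp add: prod.remove[of V v] mult.assoc)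
            then have "y * f v = mon b * (\<Prod>w\<in>V. f w ^ (\<alpha>(v := Suc (\<alpha> v))) w)" by (simp add: y mult_ac)
            moreover have "sum (\<alpha>(v := Suc (\<alpha> v))) V \<le> t"
              using y(3) lt sum_le_add_one[OF V x(3), of \<alpha>] by simp
            ultimately have "y * f v \<in> ?G t" using y(2) by blast
            then show ?case
              using step by (simp add: distrib_right scl_mult_left ratvec.span_add ratvec.span_scale ratvec.span_base)
          qed
        qed
        ultimately show ?thesis by simp
      next
        case False
        then have "?H x = 0" using xs by (auto simp: restr_zero_iff elim!: supp_mono[rotated])
        then show ?thesis by (simp add: ratvec.span_zero)
      qed
      then show ?case using step by (simp add: restr_add restr_scl ratvec.span_add ratvec.span_scale)
    qed
  qed
  finally show ?case .
qed

lemma power_le_card_bounded: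
  assumes "finite Q"
  shows "Suc K ^ card Q \<le> card (bounded Q (Suc K))"
proof -
  let ?g = "\<lambda>f. \<Sum>q\<in>Q. replicate_mset (f q) q"
  have c: "count (?g f) q = (if q \<in> Q then f q else 0)" for f q
    using assms by (simp add: count_sum)
  have "inj_on ?g (PiE Q (\<lambda>_. {..K}))"
  proof (rule inj_onI)
    fix f g assume f: "f \<in> PiE Q (\<lambda>_. {..K})" and g: "g \<in> PiE Q (\<lambda>_. {..K})" and "?g f = ?g g"
    then have "f q = g q" if "q \<in> Q" for q using c[of f q] c[of g q] that by simp
    then show "f = g" using f g by (intro PiE_ext)
  qed
  moreover have "?g ` PiE Q (\<lambda>_. {..K}) \<subseteq> bounded Q (Suc K)"
  proof
    fix m assume "m \<in> ?g ` PiE Q (\<lambda>_. {..K})"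
    then obtain f where f: "f \<in> PiE Q (\<lambda>_. {..K})" "m = ?g f" by blast
    have "q \<in> Q" if "q \<in># m" for q using that c[of f q] f(2) by (auto simp: count_greater_zero_iff[symmetric] simp del: count_greater_zero_iff split: if_splits)
    moreover have "count m q < Suc K" for q unfolding f(2) c using f(1) by (auto simp: PiE_def Pi_def less_Suc_eq_le)
    ultimately show "m \<in> bounded Q (Suc K)" by (auto simp: bounded_def over_def)
  qed
  ultimately have "card (PiE Q (\<lambda>_. {..K})) \<le> card (bounded Q (Suc K))"
    by (rule card_inj_on_le) (rule finite_bounded[OF assms])
  then show ?thesis using assms by (simp add: card_PiE)
qed

lemma mdeg_eq_sum:
  assumes "finite Q" "m \<in> over Q"
  shows "mdeg deg m = (\<Sum>q\<in>Q. count m q * deg q)"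
  using assms(2)
proof (induction m)
  case (add x m)
  then have "(\<Sum>q\<in>Q. count (add_mset x m) q * deg q) = (\<Sum>q\<in>Q. count m q * deg q + (if q = x then deg q else 0))"
    by (intro sum.cong) auto
  then show ?case using add assms(1) by (simp add: sum.distrib)
qed simp

text \<open>There are about \<open>t ^ card Q\<close> monomials of degree at most \<open>t\<close>, and they are independent. They
  lie in a span of at most about \<open>t ^ card V\<close> elements.\<close>

lemma card_generators_le:
  fixes deg :: "'i \<Rightarrow> nat" and f :: "'v \<Rightarrow> 'i galg"
  assumes Q: "finite Q" and V: "finite V"
    and f: "\<And>v. v \<in> V \<Longrightarrow> f v \<in> supp (over Q \<inter> {m. mdeg deg m = e v})"
    and e: "\<And>v. v \<in> V \<Longrightarrow> 0 < e v"
    and red: "\<And>m. m \<in> over Q \<Longrightarrow> \<exists>b \<in> supp (bounded Q N). mon m - b \<in> poly_ideal Q (f ` V)"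
  shows "card Q \<le> card V"
proof (rule ccontr)
  assume less: "\<not> card Q \<le> card V"
  define B where "B = bounded Q N"
  define s where "s = (\<Sum>q\<in>Q. deg q)"
  have B: "finite B" "B \<subseteq> over Q" using finite_bounded[OF Q] by (auto simp: B_def bounded_def)
  have bound: "Suc K ^ card Q \<le> card B * Suc (K * s) ^ card V" for K
  proof -
    let ?G = "{mon b * (\<Prod>v\<in>V. f v ^ \<alpha> v) | b \<alpha>. b \<in> B \<and> sum \<alpha> V \<le> K * s}"
    let ?I = "(\<lambda>(b, \<alpha>). mon b * (\<Prod>v\<in>V. f v ^ \<alpha> v)) ` (B \<times> PiE V (\<lambda>_. {..K * s}))"
    have "?G \<subseteq> ?I"
    proof
      fix x assume "x \<in> ?G"
      then obtain b \<alpha> where x: "x = mon b * (\<Prod>v\<in>V. f v ^ \<alpha> v)" "b \<in> B" "sum \<alpha> V \<le> K * s" by blast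
      have "\<alpha> v \<le> K * s" if "v \<in> V" for v using x(3) member_le_sum[OF that, of \<alpha>] V by simp
      then have "restrict \<alpha> V \<in> PiE V (\<lambda>_. {..K * s})" by auto
      moreover have "x = mon b * (\<Prod>v\<in>V. f v ^ restrict \<alpha> V v)" unfolding x by (simp cong: prod.cong)
      ultimately show "x \<in> ?I" using x(2) by (auto intro!: image_eqI[of _ _ "(b, restrict \<alpha> V)"])
    qed
    moreover have finI: "finite ?I" using B V by (intro finite_imageI finite_cartesian_product finite_PiE) auto
    moreover have "card ?I \<le> card B * Suc (K * s) ^ card V"
    proof -
      have "card ?I \<le> card (B \<times> PiE V (\<lambda>_. {..K * s}))"
        using B V by (intro card_image_le finite_cartesian_product finite_PiE) auto
      then show ?thesis using V by (simp add: card_cartesian_product card_PiE)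
    qed
    ultimately have finG: "finite ?G" and cG: "card ?G \<le> card B * Suc (K * s) ^ card V"
      using finite_subset card_mono[of ?I ?G] by (auto intro: order_trans)
    have "mon ` bounded Q (Suc K) \<subseteq> ratvec.span ?G"
    proof clarify
      fix m assume m: "m \<in> bounded Q (Suc K)"
      then have mQ: "m \<in> over Q" by (simp add: bounded_def)
      have "mdeg deg m = (\<Sum>q\<in>Q. count m q * deg q)" by (rule mdeg_eq_sum[OF Q mQ])
      also have "\<dots> \<le> (\<Sum>q\<in>Q. K * deg q)"
        using m by (intro sum_mono mult_right_mono) (auto simp: bounded_def less_Suc_eq_le)
      finally have "mdeg deg m \<le> K * s" by (simp add: s_def sum_distrib_left)
      then show "mon m \<in> ratvec.span ?G"
        using red unfolding B_def[symmetric] by (intro monomials_in_span[OF V f e B(2)] mQ) auto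
    qed
    then have "card (mon ` bounded Q (Suc K)) \<le> card ?G"
      using ratvec.independent_span_bound[OF finG independent_mon] by blast
    then have "card (bounded Q (Suc K)) \<le> card ?G" by (simp add: card_image inj_mon)
    then show ?thesis using power_le_card_bounded[OF Q, of K] cG by linarith
  qed
  \<comment> \<open>This exponent bound is just large enough to contradict \<open>bound\<close> when \<open>card V < card Q\<close>.\<close>
  define K where "K = card B * Suc s ^ card V"
  have "Suc K * Suc K ^ card V \<le> Suc K ^ card Q"
    using less power_increasing[of "Suc (card V)" "card Q" "Suc K"] by simp
  also have "\<dots> \<le> card B * Suc (K * s) ^ card V" by (rule bound)
  also have "\<dots> \<le> card B * (Suc s * Suc K) ^ card V"
    by (intro mult_left_mono power_mono) (auto simp: algebra_simps)
  also have "\<dots> = K * Suc K ^ card V" by (simp only: K_def power_mult_distrib mult.assoc)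
  finally show False by simp
qed


section \<open>Shearing along an odd generator\<close>

lemma mons_add_mset_iff: "i \<in> X \<Longrightarrow> i \<notin># m \<Longrightarrow> add_mset i m \<in> mons deg X \<longleftrightarrow> m \<in> mons deg X"
proof
  assume "i \<in> X" "i \<notin># m" "m \<in> mons deg X"
  then have "{#i#} + m \<in> mons deg X"
    by (intro mons_plusI) (auto simp: mons_single odds_def)
  then show "add_mset i m \<in> mons deg X" by simp
next
  assume "add_mset i m \<in> mons deg X"
  from mons_add_msetD[OF this] show "m \<in> mons deg X" by simp
qed

lemma gmul_commute_gen:
  assumes "i \<in> X" "m \<in> mons deg X"
  shows "gmul deg (mon m) (gen i) = scl ((-1) ^ (mdeg deg m * deg i)) (gmul deg (gen i) (mon m))"
  by (rule gmul_commute[of _ _ X]) (use assms in auto)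

lemma gmul_odd_square: "odd (deg i) \<Longrightarrow> gmul deg (gen i) (gen i) = 0"
  by (simp add: gen_mon gmul_mon mono_sign_odds odds_single)

lemma gmul_minus_left: "gmul deg (- p) q = - gmul deg p q"
  using gmul_diff_left[of deg 0 p q] by simp

lemma gmul_odd_gens:
  assumes "odd (deg i)" "odd (deg j)"
  shows "gmul deg (gen j) (gen i) = scl (-1) (gmul deg (gen i) (gen j))"
  by (subst gmul_commute[of "gen j" deg UNIV "gen i" "deg j" "deg i"]) (use assms in auto)

text \<open>
  The change of generators \<open>i \<mapsto> i + c \<phi>(i) j\<close> for \<open>i \<in> I\<close>, where \<open>j\<close> and all of \<open>I\<close> are odd of the same
  degree. It is the exponential of the derivation \<open>c N\<close> with \<open>N i = \<phi>(i) j\<close>. Every value of \<open>N\<close> is a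
  multiple of the odd element \<open>j\<close> and \<open>N j = 0\<close>, so \<open>N \<circ> N = 0\<close> and the exponential is \<open>1 + c N\<close>.
\<close>

locale odd_shear =
  fixes deg :: "'i::linorder \<Rightarrow> nat" and X :: "'i set" and j :: 'i and I :: "'i set" and \<phi> :: "'i \<Rightarrow> rat"
  assumes I: "finite I" "I \<subseteq> X" and j: "j \<in> X" "j \<notin> I" "odd (deg j)"
    and same_deg: "i \<in> I \<Longrightarrow> deg i = deg j"
begin

text \<open>The sign is that of moving \<open>i\<close> to the front of the monomial, where \<open>j\<close> takes its place.\<close>

definition rep :: "'i \<Rightarrow> 'i galg \<Rightarrow> 'i galg" where
  "rep i = lext (\<lambda>m. if i \<in># m then scl (mono_sign deg {#i#} (m - {#i#})) (gmul deg (gen j) (mon (m - {#i#}))) else 0)"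

definition N :: "'i galg \<Rightarrow> 'i galg" where
  "N p = (\<Sum>i\<in>I. scl (\<phi> i) (rep i p))"

definition j_multiples :: "'i galg set" where
  "j_multiples = gmul deg (gen j) ` Lam deg X"

lemma linear_rep: "linear_map_on S (rep i)"
  unfolding rep_def by (rule linear_lext)

lemmas rep_add = linear_map_onD(1)[OF linear_rep UNIV_I UNIV_I]
lemmas rep_scl = linear_map_onD(2)[OF linear_rep UNIV_I]
lemmas rep_zero = linear_map_on_zero[OF linear_rep ratvec.subspace_UNIV]

lemma linear_N: "linear_map_on S N"
  by (auto simp: linear_map_on_def N_def rep_add rep_scl ratvec.scale_right_distrib sum.distrib
      ratvec.scale_sum_right mult.commute)

lemma subspace_j_multiples: "ratvec.subspace j_multiples"
proof (rule ratvec.subspaceI)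
  show "0 \<in> j_multiples" unfolding j_multiples_def by (rule image_eqI[of _ _ 0]) (simp_all add: Lam_supp)
  show "x + y \<in> j_multiples" if xy: "x \<in> j_multiples" "y \<in> j_multiples" for x y
  proof -
    from xy obtain a b where "x = gmul deg (gen j) a" "a \<in> Lam deg X" "y = gmul deg (gen j) b" "b \<in> Lam deg X"
      unfolding j_multiples_def by blast
    then show ?thesis unfolding j_multiples_def
      by (intro image_eqI[of _ _ "a + b"]) (simp_all add: gmul_add_right ratvec.subspace_add[OF subspace_Lam])
  qed
  show "scl c x \<in> j_multiples" if x: "x \<in> j_multiples" for c x
  proof -
    from x obtain a where "x = gmul deg (gen j) a" "a \<in> Lam deg X" unfolding j_multiples_def by blast
    then show ?thesis unfolding j_multiples_def
      by (intro image_eqI[of _ _ "scl c a"]) (simp_all add: gmul_scl_right ratvec.subspace_scale[OF subspace_Lam])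
  qed
qed

lemma rep_none: "i \<notin># m \<Longrightarrow> rep i (mon m) = 0"
  by (simp add: rep_def)

lemma rep_gen_mult:
  assumes "i \<in> X" "i \<notin># m" "m \<in> mons deg X"
  shows "rep i (gmul deg (gen i) (mon m)) = gmul deg (gen j) (mon m)"
proof -
  have a: "add_mset i m \<in> mons deg X" using assms by (simp add: mons_add_mset_iff)
  show ?thesis
    by (simp add: mon_add_mset(1)[OF a] rep_scl) (simp add: rep_def mon_add_mset(2)[OF a])
qed

lemma rep_in_j_multiples:
  assumes "p \<in> Lam deg X"
  shows "rep i p \<in> j_multiples"
proof (rule linear_map_on_into[OF _ linear_rep subspace_j_multiples])
  show "p \<in> supp (mons deg X)" using assms by (simp add: Lam_supp)
  fix m assume m: "m \<in> mons deg X"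
  show "rep i (mon m) \<in> j_multiples"
  proof (cases "i \<in># m")
    case True
    have "gmul deg (gen j) (mon (m - {#i#})) \<in> j_multiples"
      unfolding j_multiples_def by (rule imageI) (simp add: mons_subset[OF m])
    then show ?thesis using True by (simp add: rep_def ratvec.subspace_scale[OF subspace_j_multiples])
  next
    case False
    then show ?thesis by (simp add: rep_none ratvec.subspace_0[OF subspace_j_multiples])
  qed
qed

lemma j_multiples_Lam: "j_multiples \<subseteq> Lam deg X"
  using j by (auto simp: j_multiples_def intro: gmul_Lam)

lemma gmul_j_j_multiples: "x \<in> j_multiples \<Longrightarrow> gmul deg (gen j) x = 0"
  using j by (auto simp: j_multiples_def gmul_odd_square simp flip: gmul_assoc)

lemma gmul_j_multiples_j_multiples:
  assumes "x \<in> j_multiples" "y \<in> j_multiples"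
  shows "gmul deg x y = 0"
proof -
  obtain z where z: "x = gmul deg (gen j) z" "z \<in> Lam deg X" using assms unfolding j_multiples_def by blast
  have "gmul deg (gmul deg (gen j) z) y \<in> {0}"
  proof (rule linear_map_on_into[where f = "\<lambda>z. gmul deg (gmul deg (gen j) z) y"])
    show "z \<in> supp (mons deg X)" using z by (simp add: Lam_supp)
    show "linear_map_on (supp (mons deg X)) (\<lambda>z. gmul deg (gmul deg (gen j) z) y)"
      by (simp add: linear_map_on_def gmul_add_right gmul_add_left gmul_scl_right gmul_scl_left)
    fix m assume m: "m \<in> mons deg X"
    obtain w where w: "y = gmul deg (gen j) w" using assms unfolding j_multiples_def by blast
    have "gmul deg (gmul deg (gen j) (mon m)) y = gmul deg (gen j) (gmul deg (gmul deg (mon m) (gen j)) w)"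
      by (simp add: w gmul_assoc)
    also have "\<dots> = scl ((-1) ^ (mdeg deg m * deg j)) (gmul deg (gmul deg (gen j) (gen j)) (gmul deg (mon m) w))"
      by (simp add: gmul_commute_gen[OF j(1) m] gmul_scl_left gmul_scl_right gmul_assoc)
    finally show "gmul deg (gmul deg (gen j) (mon m)) y \<in> {0}" using j by (simp add: gmul_odd_square)
  qed (simp add: ratvec.subspace_single_0)
  then show ?thesis by (simp add: z)
qed

lemma odd_I: "i \<in> I \<Longrightarrow> odd (deg i)"
  using same_deg j by simp

text \<open>Since \<open>i\<close> and \<open>j\<close> have the same degree, replacing \<open>i\<close> by \<open>j\<close> is a derivation of degree 0. If
  both factors contain \<open>i\<close>, their product is zero and the two terms on the right cancel because
  \<open>i\<close> and \<open>j\<close> anticommute.\<close>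

lemma rep_gmul_mon:
  assumes i: "i \<in> I" and m: "m \<in> mons deg X" and n: "n \<in> mons deg X"
  shows "rep i (gmul deg (mon m) (mon n)) = gmul deg (rep i (mon m)) (mon n) + gmul deg (mon m) (rep i (mon n))"
proof -
  have iX: "i \<in> X" and odd: "odd (deg i)" using i I odd_I by auto
  have gi: "rep i (gmul deg (gen i) z) = gmul deg (gen j) z" if z: "z \<in> supp (mons deg X \<inter> {m. i \<notin># m})" for z
    by (rule linear_map_on_eq[OF z linear_map_on_compose[OF linear_gmul_right linear_rep[of UNIV] UNIV_I] linear_gmul_right])
       (use iX rep_gen_mult in auto)
  have ni: "gmul deg (mon m) (mon n) \<in> supp (mons deg X \<inter> {m. i \<notin># m})"
    if "m \<in> mons deg X" "i \<notin># m" "n \<in> mons deg X" "i \<notin># n" for m n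
    by (rule gmul_in_supp[of _ "{m}" _ "{n}"])
       (use that in \<open>auto simp: mono_sign_odds split: if_splits intro: mons_plusI\<close>)
  have split: "\<exists>m' s. m' \<in> mons deg X \<and> i \<notin># m' \<and> mon m = scl s (gmul deg (gen i) (mon m')) \<and>
      rep i (mon m) = scl s (gmul deg (gen j) (mon m'))" if "m \<in> mons deg X" "i \<in># m" for m
  proof -
    obtain m' where m': "m = add_mset i m'" using \<open>i \<in># m\<close> multi_member_split by metis
    have "i \<notin># m'" using mons_add_mset_odd[of i m'] that odd m' by simp
    moreover have "m' \<in> mons deg X" using mons_add_msetD[of i m'] that m' by simp
    moreover have "mon m = scl (mono_sign deg {#i#} m') (gmul deg (gen i) (mon m'))"
      using mon_add_mset(3)[of i m' deg X] that m' by simp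
    moreover from this have "rep i (mon m) = scl (mono_sign deg {#i#} m') (gmul deg (gen j) (mon m'))"
      using calculation iX by (simp add: rep_scl rep_gen_mult)
    ultimately show ?thesis by blast
  qed
  have comm: "gmul deg (mon m) (gmul deg (gen k) z) = scl ((-1) ^ (mdeg deg m)) (gmul deg (gen k) (gmul deg (mon m) z))"
    if "m \<in> mons deg X" "k = i \<or> k = j" for m k z
  proof -
    have k: "k \<in> X" "odd (deg k)" using that iX j odd by auto
    then have "(-1::rat) ^ (mdeg deg m * deg k) = (-1) ^ mdeg deg m" by (simp add: minus_one_power_iff)
    then show ?thesis
      by (simp add: gmul_commute_gen[OF k(1) that(1)] gmul_scl_left flip: gmul_assoc)
  qed
  consider (none) "i \<notin># m" "i \<notin># n" | (left) "i \<in># m" "i \<notin># n" | (right) "i \<notin># m" "i \<in># n" | (both) "i \<in># m" "i \<in># n"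
    by blast
  then show ?thesis
  proof cases
    case none
    then have "rep i (gmul deg (mon m) (mon n)) = 0" by (simp add: gmul_mon rep_scl rep_none)
    then show ?thesis using none by (simp add: rep_none)
  next
    case left
    then obtain m' s where m': "m' \<in> mons deg X" "i \<notin># m'" "mon m = scl s (gmul deg (gen i) (mon m'))"
      "rep i (mon m) = scl s (gmul deg (gen j) (mon m'))" using split m by blast
    then show ?thesis using gi[OF ni[OF m'(1,2) n left(2)]] left gi[of "mon m'"]
      by (simp add: rep_none gmul_scl_left rep_scl gmul_assoc)
  next
    case right
    then obtain n' s where n': "n' \<in> mons deg X" "i \<notin># n'" "mon n = scl s (gmul deg (gen i) (mon n'))"
      "rep i (mon n) = scl s (gmul deg (gen j) (mon n'))" using split n by blast
    then show ?thesis using gi[OF ni[OF m right(1) n'(1,2)]] right gi[of "mon n'"]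
      by (simp add: rep_none gmul_scl_right rep_scl comm[OF m])
  next
    case both
    then obtain m' s where m': "m' \<in> mons deg X" "i \<notin># m'" "mon m = scl s (gmul deg (gen i) (mon m'))"
      "rep i (mon m) = scl s (gmul deg (gen j) (mon m'))" using split m by blast
    from both obtain n' t where n': "n' \<in> mons deg X" "i \<notin># n'" "mon n = scl t (gmul deg (gen i) (mon n'))"
      "rep i (mon n) = scl t (gmul deg (gen j) (mon n'))" using split n by blast
    have "gmul deg (mon m) (mon n) = 0"
      by (simp add: m'(3) n'(3) gmul_scl_left gmul_scl_right gmul_assoc comm[OF m'(1)])
        (simp add: gmul_odd_square odd flip: gmul_assoc)
    moreover have "gmul deg (rep i (mon m)) (mon n) + gmul deg (mon m) (rep i (mon n)) = 0"
      unfolding m'(4) n'(4) unfolding m'(3) n'(3)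
      by (simp add: gmul_scl_left gmul_scl_right gmul_assoc comm[OF m'(1)])
        (simp add: gmul_odd_gens[where deg = deg, OF odd j(3)] gmul_minus_left mult.commute flip: gmul_assoc ratvec.scale_right_distrib)
    ultimately show ?thesis by (simp add: rep_zero)
  qed
qed

lemma rep_gmul:
  assumes i: "i \<in> I" and p: "p \<in> Lam deg X" and q: "q \<in> Lam deg X"
  shows "rep i (gmul deg p q) = gmul deg (rep i p) q + gmul deg p (rep i q)"
proof -
  have p': "p \<in> supp (mons deg X)" and q': "q \<in> supp (mons deg X)" using p q by (simp_all add: Lam_supp)
  have 1: "rep i (gmul deg (mon m) q) = gmul deg (rep i (mon m)) q + gmul deg (mon m) (rep i q)" if "m \<in> mons deg X" for m
    by (rule linear_map_on_eq[OF q'])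
       (use rep_gmul_mon[OF i that] in \<open>simp_all add: linear_map_on_def rep_add rep_scl gmul_add_right gmul_scl_right
         ratvec.scale_right_distrib algebra_simps\<close>)
  show ?thesis
    by (rule linear_map_on_eq[OF p', where f = "\<lambda>p. rep i (gmul deg p q)"])
       (use 1 in \<open>simp_all add: linear_map_on_def rep_add rep_scl gmul_add_left gmul_scl_left
         ratvec.scale_right_distrib algebra_simps\<close>)
qed

lemma N_in_j_multiples: "p \<in> Lam deg X \<Longrightarrow> N p \<in> j_multiples"
  unfolding N_def by (intro ratvec.subspace_sum[OF subspace_j_multiples] ratvec.subspace_scale[OF subspace_j_multiples] rep_in_j_multiples)

lemma N_gmul:
  assumes "p \<in> Lam deg X" "q \<in> Lam deg X"
  shows "N (gmul deg p q) = gmul deg (N p) q + gmul deg p (N q)"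
  using assms by (simp add: N_def rep_gmul gmul_sum_left gmul_sum_right gmul_scl_left gmul_scl_right
      ratvec.scale_right_distrib sum.distrib)

lemma N_N:
  assumes "p \<in> Lam deg X"
  shows "N (N p) = 0"
proof -
  obtain z where z: "N p = gmul deg (gen j) z" "z \<in> Lam deg X"
    using N_in_j_multiples[OF assms] unfolding j_multiples_def by blast
  have "rep i (gen j) = 0" if "i \<in> I" for i
    using that j by (auto simp: gen_mon intro: rep_none)
  then have "N (gen j) = 0" by (simp add: N_def)
  then have "N (N p) = gmul deg (gen j) (N z)" using N_gmul[of "gen j" z] z j by simp
  then show ?thesis using gmul_j_j_multiples[OF N_in_j_multiples[OF z(2)]] by simp
qed

lemma rep_in_supp:
  assumes "p \<in> supp M" "\<And>m. m \<in> M \<Longrightarrow> i \<in># m \<Longrightarrow> add_mset j (m - {#i#}) \<in> K"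
  shows "rep i p \<in> supp K"
proof (rule linear_map_on_into[OF assms(1) linear_rep subspace_supp])
  fix m assume "m \<in> M"
  then show "rep i (mon m) \<in> supp K"
    using assms(2) by (auto simp: rep_def gen_mon gmul_mon intro!: supp_scl)
qed

lemma N_homog: "homog deg k p \<Longrightarrow> homog deg k (N p)"
  unfolding N_def homog_supp
proof (intro ratvec.subspace_sum[OF subspace_supp] supp_scl)
  fix i assume p: "p \<in> supp {m. mdeg deg m = k}" and i: "i \<in> I"
  show "rep i p \<in> supp {m. mdeg deg m = k}"
  proof (rule rep_in_supp[OF p])
    fix m assume "m \<in> {m. mdeg deg m = k}" "i \<in># m"
    then show "add_mset j (m - {#i#}) \<in> {m. mdeg deg m = k}"
      using same_deg[OF i] by (auto dest!: multi_member_split)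
  qed
qed

definition shear :: "rat \<Rightarrow> 'i galg \<Rightarrow> 'i galg" where
  "shear c p = p + scl c (N p)"

lemma linear_shear: "linear_map_on S (shear c)"
  using linear_N[of UNIV] by (simp add: linear_map_on_def shear_def ratvec.scale_right_distrib mult.commute)

lemma shear_Lam: "p \<in> Lam deg X \<Longrightarrow> shear c p \<in> Lam deg X"
  unfolding shear_def using N_in_j_multiples j_multiples_Lam
  by (intro ratvec.subspace_add[OF subspace_Lam] ratvec.subspace_scale[OF subspace_Lam]) auto

lemma shear_homog: "homog deg k p \<Longrightarrow> homog deg k (shear c p)"
  unfolding shear_def using N_homog by (auto simp: homog_supp intro: supp_add supp_scl)

lemma shear_inverse: "p \<in> Lam deg X \<Longrightarrow> shear c (shear (- c) p) = p"
  using linear_map_onD[OF linear_N[of UNIV]] linear_map_on_diff[OF linear_N ratvec.subspace_UNIV UNIV_I UNIV_I]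
  by (simp add: shear_def N_N)

lemma shear_gone: "shear c gone = gone"
proof -
  have "rep i gone = 0" for i by (simp add: gone_mon rep_none)
  then show ?thesis by (simp add: shear_def N_def)
qed

lemma shear_gmul:
  assumes "p \<in> Lam deg X" "q \<in> Lam deg X"
  shows "shear c (gmul deg p q) = gmul deg (shear c p) (shear c q)"
  using gmul_j_multiples_j_multiples[OF N_in_j_multiples[OF assms(1)] N_in_j_multiples[OF assms(2)]]
  by (simp add: shear_def N_gmul assms gmul_add_left gmul_add_right gmul_scl_left gmul_scl_right
      ratvec.scale_right_distrib)

lemma conjugate:
  assumes "differential deg X d"
  shows "differential deg X (\<lambda>p. shear 1 (d (shear (-1) p)))"
    and "dga_iso deg X (\<lambda>p. shear 1 (d (shear (-1) p))) deg X d (shear (-1))"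
proof -
  interpret dga deg X d by standard (rule assms)
  note L = shear_Lam D_Lam gmul_Lam
  have inv: "shear (-1) (shear 1 p) = p" "shear 1 (shear (-1) p) = p" if "p \<in> Lam deg X" for p
    using shear_inverse[OF that, of 1] shear_inverse[OF that, of "-1"] by simp_all
  show "differential deg X (\<lambda>p. shear 1 (d (shear (-1) p)))"
    unfolding differential_def
  proof (intro conjI ballI allI impI)
    show "linear_map_on (Lam deg X) (\<lambda>p. shear 1 (d (shear (-1) p)))"
      by (intro linear_map_on_compose[OF linear_map_on_compose[OF linear_shear D_linear] linear_shear[of UNIV]])
         (auto intro: L)
  next
    fix k p q assume "p \<in> Lam deg X" "q \<in> Lam deg X" "homog deg k p"
    then show "shear 1 (d (shear (-1) (gmul deg p q))) = gmul deg (shear 1 (d (shear (-1) p))) q +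
        scl ((-1) ^ k) (gmul deg p (shear 1 (d (shear (-1) q))))"
      by (simp add: shear_gmul D_gmul[OF _ _ shear_homog] L linear_map_onD[OF linear_shear[of UNIV]] inv)
  next
    fix k p assume "p \<in> Lam deg X" "homog deg k p"
    then show "homog deg (k + 1) (shear 1 (d (shear (-1) p)))"
      by (intro shear_homog D_homog L)
  qed (auto simp: L inv D_D linear_map_on_zero[OF linear_shear ratvec.subspace_UNIV])
  show "dga_iso deg X (\<lambda>p. shear 1 (d (shear (-1) p))) deg X d (shear (-1))"
    unfolding dga_iso_def
  proof (intro conjI ballI allI impI)
    show "bij_betw (shear (-1)) (Lam deg X) (Lam deg X)"
      by (rule bij_betw_byWitness[where f' = "shear 1"]) (auto simp: inv L)
  qed (auto simp: L inv shear_gone shear_gmul linear_shear intro: shear_homog)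
qed

end

section \<open>Maximality of the second stage\<close>

context quad_model
begin

text \<open>The assumption \<open>contr\<close> says that the contraction of \<open>d v\<close> with \<open>\<phi>\<close> is zero for each \<open>v\<close>. If
  \<open>\<phi> j\<close> is not zero, the shear that replaces the other generators \<open>i \<in> I\<close> by
  \<open>i - (\<phi> i / \<phi> j) j\<close>, which span the kernel of \<open>\<phi>\<close> on \<open>I\<close>, removes \<open>j\<close> from all the \<open>d v\<close>. In
  the sheared model \<open>j\<close> can be counted as a generator of the second stage.\<close>

lemma maximal_imp_no_free_direction:
  assumes max: "displays_max deg U V d"
    and I: "I \<subseteq> U" "\<And>i. i \<in> I \<Longrightarrow> deg i = k" and k: "odd k"
    and contr: "\<And>v w. v \<in> V \<Longrightarrow> w \<in> U \<Longrightarrow>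
       (\<Sum>i\<in>I. \<phi> i * mono_sign deg {#i#} {#w#} * lookup (d (gen v)) {#i, w#}) = 0"
    and j: "j \<in> I"
  shows "\<phi> j = 0"
proof (rule ccontr)
  assume \<phi>: "\<phi> j \<noteq> 0"
  let ?X = "U \<union> V"
  interpret S: odd_shear deg ?X j "I - {j}" "\<lambda>i. \<phi> i / \<phi> j"
    by standard (use I k j finite_U in \<open>auto intro: finite_subset\<close>)
  let ?d = "\<lambda>p. S.shear 1 (d (S.shear (-1) p))"
  let ?U = "U - {j}" and ?V = "insert j V"
  have X: "?U \<union> ?V = ?X" using I j by auto
  have finI: "finite I" using I finite_U finite_subset by blast
  have jV: "j \<notin> V" using disjoint I j by auto
  have shear_gen: "S.shear (-1) (gen i) = gen i" if "i \<notin> I - {j}" for i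
  proof -
    have "S.rep l (gen i) = 0" if "l \<in> I - {j}" for l
      using that \<open>i \<notin> I - {j}\<close> by (auto simp: gen_mon intro: S.rep_none)
    then show ?thesis by (simp add: S.shear_def S.N_def)
  qed
  have shear_gen_I: "S.shear (-1) (gen i) = gen i - scl (\<phi> i / \<phi> j) (gen j)" if i: "i \<in> I - {j}" for i
  proof -
    have "S.rep l (gen i) = (if l = i then gen j else 0)" if "l \<in> I - {j}" for l
      using S.rep_gen_mult[of i "{#}"] i I by (auto simp: gen_mon S.rep_none gmul_mon simp flip: gone_mon)
    then have "S.N (gen i) = (\<Sum>l\<in>I - {j}. if l = i then scl (\<phi> i / \<phi> j) (gen j) else 0)"
      unfolding S.N_def by (intro sum.cong) auto
    then show ?thesis using i finI by (simp add: S.shear_def)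
  qed
  have dU': "?d (gen u) = 0" if "u \<in> U" for u
  proof -
    have "d (S.shear (-1) (gen u)) = 0"
      using that I j dU by (cases "u \<in> I - {j}")
        (auto simp: shear_gen shear_gen_I D_diff D_scl ratvec.subspace_scale[OF subspace_Lam] subset_iff)
    then show ?thesis by (simp add: linear_map_on_zero[OF S.linear_shear ratvec.subspace_UNIV])
  qed
  have dV': "?d (gen v) \<in> supp {m \<in> mons deg ?U. size m = 2}" if v: "v \<in> V" for v
  proof -
    have "v \<notin> I - {j}" using v I disjoint by auto
    then have e: "?d (gen v) = S.shear 1 (d (gen v))" by (simp add: shear_gen)
    let ?z = "d (gen v)"
    have z: "?z \<in> supp {m \<in> mons deg U. size m = 2}" using dV v by simp
    have Nz: "S.N ?z \<in> supp {m. set_mset m \<subseteq> U \<and> size m = 2}"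
      unfolding S.N_def
    proof (intro ratvec.subspace_sum[OF subspace_supp] supp_scl S.rep_in_supp[OF z])
      fix i m assume "m \<in> {m \<in> mons deg U. size m = 2}" "i \<in># m"
      then show "add_mset j (m - {#i#}) \<in> {m. set_mset m \<subseteq> U \<and> size m = 2}"
        using I j by (auto simp: mons_def dest!: multi_member_split)
    qed
    have "?z \<in> supp {m. set_mset m \<subseteq> U \<and> size m = 2}" using z by (rule supp_mono[rotated]) (auto simp: mons_def)
    with Nz have s1: "S.shear 1 ?z \<in> supp {m. set_mset m \<subseteq> U \<and> size m = 2}" by (simp add: S.shear_def supp_add)
    have s2: "S.shear 1 ?z \<in> supp (mons deg ?X)"
      using S.shear_Lam[OF D_Lam, of "gen v"] v unfolding Lam_supp[symmetric] by simp
    have repz: "lookup (S.rep i ?z) {#j, w#} = mono_sign deg {#i#} {#w#} * mono_sign deg {#j#} {#w#} * lookup ?z {#i, w#}"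
      if i: "i \<in> I - {j}" and w: "w \<noteq> j" for i w
    proof -
      show ?thesis using z
      proof (induction rule: supp_induct)
        case (mon m)
        show ?case
        proof (cases "i \<in># m")
          case True
          then obtain n where n: "m = add_mset i n" using multi_member_split by metis
          then have "size n = 1" using mon by simp
          then obtain b where "n = {#b#}" using size_1_singleton_mset by blast
          then show ?thesis
            by (simp add: n S.rep_def gen_mon gmul_mon lookup_scl lookup_single when_def)
        next
          case False
          then have "m \<noteq> {#i, w#}" by auto
          then show ?thesis using False by (simp add: S.rep_none lookup_single when_def)
        qed
      qed (simp_all add: S.rep_zero S.rep_add S.rep_scl lookup_add lookup_scl algebra_simps)
    qed
    have "lookup (S.shear 1 ?z) m = 0" if m: "m \<notin> {m \<in> mons deg ?U. size m = 2}" for m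
    proof (cases "m \<in> mons deg ?X \<and> set_mset m \<subseteq> U \<and> size m = 2")
      case False
      then show ?thesis using s1 s2 unfolding supp_iff by blast
    next
      case True
      then obtain a b where ab: "m = {#a, b#}" using size_2_mset by blast
      have "j \<in># m" using m True by (auto simp: mons_def)
      then obtain w where mw: "m = {#j, w#}" using ab by (auto simp: add_mset_commute)
      have w: "w \<noteq> j" using mons_add_mset_odd[of j "{#w#}" deg ?X] True mw S.j by auto
      have wU: "w \<in> U" using True mw by simp
      have sq: "mono_sign deg {#j#} {#w#} * mono_sign deg {#j#} {#w#} = 1"
        using mon_add_mset(2)[of j "{#w#}" deg ?X] True mw by simp
      have "lookup (S.shear 1 ?z) m = lookup ?z {#j, w#} + (\<Sum>i\<in>I - {j}. \<phi> i / \<phi> j *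
          (mono_sign deg {#i#} {#w#} * mono_sign deg {#j#} {#w#} * lookup ?z {#i, w#}))"
        by (simp add: S.shear_def S.N_def lookup_add lookup_scl lookup_sum mw repz[OF _ w])
      also have "\<dots> = mono_sign deg {#j#} {#w#} / \<phi> j *
         (\<phi> j * mono_sign deg {#j#} {#w#} * lookup ?z {#j, w#} +
          (\<Sum>i\<in>I - {j}. \<phi> i * mono_sign deg {#i#} {#w#} * lookup ?z {#i, w#}))"
      proof -
        have "mono_sign deg {#j#} {#w#} / \<phi> j * (\<phi> j * mono_sign deg {#j#} {#w#} * lookup ?z {#j, w#})
          = (mono_sign deg {#j#} {#w#} * mono_sign deg {#j#} {#w#}) * lookup ?z {#j, w#}"
          using \<phi> by simp
        then show ?thesis unfolding sq distrib_left sum_distrib_left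
          by (auto intro!: sum.cong)
      qed
      also have "\<dots> = 0" using contr[OF v wU] by (simp add: sum.remove[OF finI j])
      finally show ?thesis .
    qed
    then show ?thesis unfolding e supp_iff by blast
  qed
  have two: "two_stage deg ?U ?V ?d"
    unfolding two_stage_def minimal_model_def X
  proof (intro conjI ballI)
    show "?U \<inter> ?V = {}" using disjoint by auto
    show "differential deg ?X ?d" by (rule S.conjugate(1)[OF differential])
    have lin: "?d w \<in> W" if w: "w \<in> lin Y" and Y: "Y \<subseteq> ?X" and W: "ratvec.subspace W" "\<And>i. i \<in> Y \<Longrightarrow> ?d (gen i) \<in> W" for Y W w
    proof (rule linear_map_on_into[OF _ _ W(1), of w "(\<lambda>i. {#i#}) ` Y" ?d])
      have "gen ` Y \<subseteq> supp ((\<lambda>i. {#i#}) ` Y)" by (auto simp: gen_mon)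
      then show "w \<in> supp ((\<lambda>i. {#i#}) ` Y)"
        using w ratvec.span_minimal[OF _ subspace_supp] unfolding lin_def by blast
      show "linear_map_on (supp ((\<lambda>i. {#i#}) ` Y)) ?d"
      proof (rule linear_map_on_subset)
        show "linear_map_on (Lam deg ?X) ?d"
          using S.conjugate(1)[OF differential] unfolding differential_def by blast
        have "(\<lambda>i. {#i#}) ` Y \<subseteq> mons deg ?X" using Y by (auto simp: mons_single)
        then show "supp ((\<lambda>i. {#i#}) ` Y) \<subseteq> Lam deg ?X" unfolding Lam_supp supp_def by blast
      qed
      show "\<And>m. m \<in> (\<lambda>i. {#i#}) ` Y \<Longrightarrow> ?d (mon m) \<in> W" using W(2) by (auto simp: gen_mon)
    qed
    show "?d w = 0" if "w \<in> lin ?U" for w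
      using lin[OF that, of "{0}"] dU' by (auto simp: ratvec.subspace_single_0)
    show "?d w \<in> Lam deg ?U" if "w \<in> lin ?V" for w
    proof (rule lin[OF that _ subspace_Lam])
      show "?V \<subseteq> ?X" using I j by auto
      fix i assume "i \<in> ?V"
      then show "?d (gen i) \<in> Lam deg ?U"
        using dU'[of j] dV'[of i] I j by (auto simp: Lam_supp elim!: supp_mono[rotated])
    qed
    show "size m \<noteq> 1" if "w \<in> lin ?X" "m \<in> keys (?d w)" for w m
    proof -
      have "?d w \<in> supp {m. size m = 2}"
      proof (rule lin[OF that(1) subset_refl subspace_supp])
        fix i assume "i \<in> ?X"
        then show "?d (gen i) \<in> supp {m. size m = 2}"
          using dU'[of i] dV'[of i] by (auto elim!: supp_mono[rotated])
      qed
      then show ?thesis using that(2) by (auto simp: supp_def)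
    qed
    show "2 \<le> deg i" if "i \<in> ?X" for i using deg_ge_2[OF that] .
  qed
  moreover have "\<exists>f. dga_iso deg (?U \<union> ?V) ?d deg (U \<union> V) d f"
    unfolding X using S.conjugate(2)[OF differential] by blast
  ultimately have "ratvec.dim (lin ?V) \<le> ratvec.dim (lin V)"
    using max unfolding displays_max_def by blast
  then show False using jV finite_V by (simp add: dim_lin)
qed

end


section \<open>Even cocycles of a quadratic model\<close>

lemma separating_functional:
  assumes W: "ratvec.subspace W" and x: "x \<notin> W"
  obtains l where "\<And>p q. l (p + q) = l p + l q" "\<And>c p. l (scl c p) = c * l p"
    "\<And>p. p \<in> W \<Longrightarrow> l p = 0" "l x = (1::rat)"
proof -
  interpret rat: vector_space "(*) :: rat \<Rightarrow> rat \<Rightarrow> rat"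
    by unfold_locales (auto simp: algebra_simps)
  interpret pair: vector_space_pair scl "(*) :: rat \<Rightarrow> rat \<Rightarrow> rat" ..
  obtain B where B: "B \<subseteq> W" "ratvec.independent B" "W \<subseteq> ratvec.span B"
    by (rule ratvec.basis_exists[of W])
  have "x \<notin> ratvec.span B" using x ratvec.span_minimal[OF B(1) W] by auto
  then have "ratvec.independent (insert x B)" using B(2) by (rule ratvec.independent_insertI)
  then obtain l where l: "Vector_Spaces.linear scl (*) l" "\<forall>y\<in>insert x B. l y = (if y = x then 1 else 0)"
    using pair.linear_independent_extend[of "insert x B" "\<lambda>y. if y = x then 1 else 0"] by auto
  interpret l: Vector_Spaces.linear scl "(*)" l by (rule l(1))
  have "l y = 0" if "y \<in> ratvec.span B" for y
    using that
  proof (induction rule: ratvec.span_induct_alt)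
    case (step c a b)
    then have "l a = 0" using l(2) B(1) x by auto
    then show ?case using step by (simp add: l.add l.scale)
  qed (simp add: l.zero)
  then show thesis using that[of l] l(2) B(3) by (auto simp: l.add l.scale)
qed

lemma quad_modelI:
  assumes "two_stage deg U V d" "elliptic deg (U \<union> V) d"
    and "\<forall>v \<in> lin V. d v \<in> Lam_len deg 2 U"
  shows "quad_model deg U V d"
proof
  show "d (gen v) \<in> supp {m \<in> mons deg U. size m = 2}" if "v \<in> V" for v
    using assms(3) lin_gen[OF that] by (fastforce simp: Lam_len_def Lam_supp supp_def)
  show "d (gen u) = 0" if "u \<in> U" for u
    using assms(1) lin_gen[OF that] by (auto simp: two_stage_def)
qed (use assms(1,2) in \<open>auto simp: two_stage_def elliptic_def minimal_model_def\<close>)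

context quad_model
begin

lemma d_Lam_U: "p \<in> Lam deg U \<Longrightarrow> d p = 0"
  using D_in_ideal[of U "{0}" p] by (auto simp: dU ratvec.subspace_single_0)

lemma even_power_exact:
  "\<exists>N. \<forall>k\<ge>N. \<forall>u\<in>even_part deg U. \<exists>\<Psi>\<in>Lam deg (U \<union> V).
     homog deg (k * deg u - 1) \<Psi> \<and> mon (replicate_mset k u) = d \<Psi>"
proof -
  obtain N where N: "exact_from deg (U \<union> V) d {} N" using exact_from_finite[OF finite_cohomology] ..
  have "\<exists>\<Psi>\<in>Lam deg (U \<union> V). homog deg (k * deg u - 1) \<Psi> \<and> mon (replicate_mset k u) = d \<Psi>"
    if k: "N \<le> k" and u: "u \<in> even_part deg U" for k u
  proof -
    have m: "replicate_mset k u \<in> mons deg U"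
      using u by (auto simp: mons_def even_part_def)
    then have L: "mon (replicate_mset k u) \<in> Lam deg (U \<union> V)"
      using mons_mset_subset[of U "U \<union> V"] by simp
    have "2 \<le> deg u" using u deg_ge_2[of u] by (simp add: even_part_def)
    then have "N \<le> k * deg u" using k by (metis le_trans le_square mult_le_mono2 nat_mult_1_right one_le_numeral)
    moreover have "d (mon (replicate_mset k u)) = 0" using m by (intro d_Lam_U) simp
    ultimately obtain \<Psi> where "\<Psi> \<in> Lam deg (U \<union> V)" "homog deg (k * deg u - 1) \<Psi>"
      "mon (replicate_mset k u) - d \<Psi> \<in> supp (meets {})"
      using N L unfolding exact_from_def by (metis homog_mon image_replicate_mset sum_mset_replicate_mset zero_in_supp of_nat_id)
    then show ?thesis by (auto simp: supp_def)
  qed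
  then show ?thesis by blast
qed

text \<open>The case of no torus generators, proved without an extension. It makes the difference in the
  final bound non-negative even if the supremum that defines the toral rank is taken over the
  empty set.\<close>

lemma card_even_le: "card (even_part deg U) \<le> card V"
proof -
  let ?Q = "even_part deg U"
  interpret dga_even deg "U \<union> V" d ?Q by standard (auto simp: even_part_def)
  let ?f = "\<lambda>v. sigma (d (gen v))"
  obtain N where N: "\<And>k u. N \<le> k \<Longrightarrow> u \<in> ?Q \<Longrightarrow> \<exists>\<Psi>\<in>Lam deg (U \<union> V). mon (replicate_mset k u) = d \<Psi>"
    using even_power_exact by blast
  have J: "sigma (d p) \<in> poly_ideal ?Q (?f ` V)" if "p \<in> Lam deg (U \<union> V)" for p
    by (rule sigma_D_in_ideal[OF _ that]) (auto simp: dU poly_ideal_zero intro: poly_ideal_base)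
  show ?thesis
  proof (rule card_generators_le[where e = "\<lambda>v. deg v + 1" and f = ?f and deg = deg and N = "Suc N"])
    show "finite ?Q" using finite_U by (simp add: even_part_def)
    show "?f v \<in> supp (over ?Q \<inter> {m. mdeg deg m = deg v + 1})" if "v \<in> V" for v
    proof -
      have "homog deg (deg v + 1) (d (gen v))" using that by (intro D_homog) auto
      then show ?thesis by (simp add: homog_supp restr_supp flip: supp_Int)
    qed
    fix m assume m: "m \<in> over ?Q"
    show "\<exists>b\<in>supp (bounded ?Q (Suc N)). mon m - b \<in> poly_ideal ?Q (?f ` V)"
    proof (rule congruent_bounded[where A = "{}" and deg = deg])
      fix q assume q: "q \<in> ?Q - {}"
      then obtain \<Psi> where \<Psi>: "\<Psi>\<in>Lam deg (U \<union> V)" "mon (replicate_mset (Suc N) q) = d \<Psi>"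
        using N[of "Suc N" q] by auto
      moreover have "sigma (mon (replicate_mset (Suc N) q)) = mon (replicate_mset (Suc N) q)"
        using q by (simp add: restr_mon over_def)
      ultimately have "mon (replicate_mset (Suc N) q) \<in> poly_ideal ?Q (?f ` V)" using J by metis
      then show "\<exists>r\<in>supp (over ?Q \<inter> meets {} \<inter> {m. mdeg deg m = Suc N * deg q}).
         mon (replicate_mset (Suc N) q) - r \<in> poly_ideal ?Q (?f ` V)"
        by (intro bexI[of _ 0]) simp_all
    next
      show "0 < deg q" if "q \<in> ?Q" for q using that deg_ge_2[of q] by (simp add: even_part_def)
    qed (use m in auto)
  qed (use finite_V in auto)
qed

end

section \<open>Toral extensions\<close>

lemma tau_eq_zero:
  assumes "p \<in> supp {m. \<not> (u \<in># m \<and> m - {#u#} \<in> over Q)}"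
  shows "tau Q u p = 0"
proof -
  have "tau Q u p \<in> {0}"
    by (rule linear_map_on_into[OF assms linear_tau ratvec.subspace_single_0]) (auto simp: tau_mon)
  then show ?thesis by simp
qed

lemma mono_sign_ext:
  "mono_sign (ext_deg deg) {#Inr x#} {#Inr w :: nat + 'i#} = mono_sign deg {#x#} {#w :: 'i::linorder#}"
proof -
  have "{(i, k). i = (Inr x :: nat + 'i) \<and> k = Inr w \<and> k < i} = (\<lambda>(i, k). (Inr i, Inr k)) ` {(i, k). i = x \<and> k = w \<and> k < i}"
    by (auto simp: less_sum_def less_eq_sum_def)
  then have "invs {Inr x :: nat + 'i} {Inr w} = invs {x} {w}"
    unfolding invs_def by (auto simp: card_image inj_on_def)
  then show ?thesis by (auto simp: mono_sign_odds odds_single ext_deg_def)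
qed

lemma mdeg_0_iff:
  assumes "m \<in> mons deg X" "\<And>x. x \<in> X \<Longrightarrow> 0 < deg x"
  shows "mdeg deg m = 0 \<longleftrightarrow> m = {#}"
  using assms by (cases m) (auto simp: mons_def)

lemma ext_proj_add: "ext_proj (p + q) = ext_proj p + ext_proj q"
  and ext_proj_scl: "ext_proj (scl c p) = scl c (ext_proj p)"
  and ext_proj_diff: "ext_proj (p - q) = ext_proj p - ext_proj q"
  by (rule poly_mapping_eqI; simp add: lookup_ext_proj lookup_add lookup_scl lookup_minus)+

lemma ext_proj_mon: "ext_proj (mon (image_mset Inr m)) = mon m"
  by (rule poly_mapping_eqI) (auto simp: lookup_ext_proj lookup_single when_def dest: injD[OF inj_image_mset_Inr])

definition emb :: "'i galg \<Rightarrow> (nat + 'i) galg" where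
  "emb = lext (\<lambda>m. mon (image_mset Inr m))"

lemma ext_proj_emb: "ext_proj (emb p) = p"
  by (rule linear_map_on_eq[of p UNIV "\<lambda>p. ext_proj (emb p)"])
     (simp_all add: linear_map_on_def emb_def lext_add lext_scl ext_proj_add ext_proj_scl ext_proj_mon)

lemma emb_in_supp:
  assumes "p \<in> supp M" "\<And>m. m \<in> M \<Longrightarrow> image_mset Inr m \<in> K"
  shows "emb p \<in> supp K"
  unfolding emb_def
  by (rule linear_map_on_into[OF assms(1) linear_lext subspace_supp]) (simp add: assms(2))

lemma mdeg_ext: "mdeg (ext_deg deg) (image_mset Inr m) = mdeg deg m"
  by (induction m) (auto simp: ext_deg_def)

lemma image_Inr_mons:
  fixes deg :: "'a \<Rightarrow> nat"
  shows "m \<in> mons deg X \<Longrightarrow> image_mset Inr m \<in> mons (ext_deg deg) (ext_gens n X)"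
proof -
  assume m: "m \<in> mons deg X"
  have "count (image_mset Inr m) (Inr i :: nat + 'a) = count m i" for i
    by (induction m) auto
  moreover have "count (image_mset Inr m) (Inl i :: nat + 'a) = 0" for i
    by (auto simp: count_eq_zero_iff)
  ultimately show ?thesis
    using m by (auto simp: mons_def ext_gens_def ext_deg_def split: sum.splits)
qed

lemma no_Inl_imp_image:
  assumes "\<And>x. x \<in># m \<Longrightarrow> x \<in> range Inr"
  shows "m = image_mset Inr (image_mset projr m)"
proof -
  have "image_mset (Inr \<circ> projr) m = image_mset id m"
    by (rule image_mset_cong) (use assms in fastforce)
  then show ?thesis by (simp add: multiset.map_comp)
qed


locale toral_extension = quad_model deg U V d
  for deg :: "'i::linorder \<Rightarrow> nat" and U V :: "'i set" and d :: "'i galg \<Rightarrow> 'i galg" +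
  fixes n :: nat and D :: "(nat + 'i) galg \<Rightarrow> (nat + 'i) galg"
  assumes KS: "KS_extension deg (U \<union> V) d n D"
    and finite_D: "finite_dim_cohomology (ext_deg deg) (ext_gens n (U \<union> V)) D"
begin

abbreviation "edeg \<equiv> ext_deg deg"
abbreviation "A \<equiv> (Inl ` {..<n} :: (nat + 'i) set)"
abbreviation "XE \<equiv> ext_gens n (U \<union> V)"
definition "Q = A \<union> Inr ` even_part deg U"

lemma differential_D: "differential edeg XE D"
  and D_Inl: "j < n \<Longrightarrow> D (gen (Inl j)) = 0"
  and proj_D: "p \<in> Lam edeg XE \<Longrightarrow> ext_proj (D p) = d (ext_proj p)"
  using KS by (simp_all add: KS_extension_def)

lemma edeg_simps [simp]: "edeg (Inl j) = 2" "edeg (Inr i) = deg i"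
  by (simp_all add: ext_deg_def)

lemma Inr_in_XE [simp]: "Inr i \<in> XE \<longleftrightarrow> i \<in> U \<union> V"
  and Inl_in_XE [simp]: "Inl j \<in> XE \<longleftrightarrow> j < n"
  by (auto simp: ext_gens_def)

lemma Q_even: "q \<in> Q \<Longrightarrow> even (edeg q)"
  by (auto simp: Q_def even_part_def)

lemma Q_sub: "Q \<subseteq> XE"
  by (auto simp: Q_def even_part_def)

lemma XE_ge_2: "x \<in> XE \<Longrightarrow> 2 \<le> edeg x"
  using deg_ge_2 by (auto simp: ext_gens_def)

lemma not_Q:
  assumes "x \<in> XE" "x \<notin> Q"
  obtains i where "x = Inr i" "i \<in> U \<union> V" "odd (deg i)"
  using assms V_odd by (auto simp: ext_gens_def Q_def even_part_def)

sublocale E: dga_even edeg XE D Q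
  by standard (simp_all add: differential_D Q_even)

abbreviation "f x \<equiv> E.sigma (D (gen x))"
abbreviation "J \<equiv> poly_ideal Q ((\<lambda>v. f (Inr v)) ` V)"

lemma lookup_D_Inr:
  assumes "i \<in> U \<union> V"
  shows "lookup (D (gen (Inr i))) (image_mset Inr m) = lookup (d (gen i)) m"
proof -
  have "ext_proj (gen (Inr i)) = gen i" using ext_proj_mon[of "{#i#}"] by (simp add: gen_mon)
  then have "ext_proj (D (gen (Inr i))) = d (gen i)" using proj_D[of "gen (Inr i)"] assms by simp
  then show ?thesis by (metis lookup_ext_proj)
qed

text \<open>A linear term of \<open>D w\<close> cannot lie in \<open>A\<close>, whose degree 2 is too small, and cannot lie in
  \<open>U \<union> V\<close> either, because \<open>d\<close> is quadratic.\<close>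

lemma keys_D:
  assumes "i \<in> U \<union> V" "m \<in> keys (D (gen (Inr i)))"
  shows "m \<in> mons edeg XE" "mdeg edeg m = deg i + 1" "size m \<noteq> 1"
proof -
  have L: "gen (Inr i) \<in> Lam edeg XE" using assms by simp
  show 1: "m \<in> mons edeg XE" using E.D_Lam[OF L] assms(2) by (auto simp: Lam_supp supp_def)
  have "homog edeg (deg i + 1) (D (gen (Inr i)))" by (rule E.D_homog[OF L]) simp
  then show 2: "mdeg edeg m = deg i + 1" using assms(2) by (simp add: homog_def)
  show "size m \<noteq> 1"
  proof
    assume "size m = 1"
    then obtain x where x: "m = {#x#}" using size_1_singleton_mset by blast
    show False
    proof (cases x)
      case (Inl j)
      then show False using 2 deg_ge_2[OF assms(1)] x by simp
    next
      case (Inr k)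
      then have "lookup (d (gen i)) {#k#} \<noteq> 0"
        using lookup_D_Inr[OF assms(1), of "{#k#}"] assms(2) x by (simp add: in_keys_iff)
      moreover have "d (gen i) \<in> supp {m. size m = 2}"
        using assms(1) dU[of i] dV[of i] by (auto elim!: supp_mono[rotated])
      ultimately show False by (auto simp: supp_iff)
    qed
  qed
qed

text \<open>The contribution of one monomial \<open>m\<close> of \<open>D v\<close> to the coefficient of \<open>w\<close> in \<open>D(D v)\<close>. Modulo \<open>J\<close>
  only the monomials \<open>u w\<close> with \<open>u \<in> U\<close> odd of degree \<open>k\<close> count: a product \<open>p w\<close> with a polynomial
  coefficient contributes a multiple of \<open>f p\<close>, and \<open>p\<close> is in \<open>V\<close> or has degree below \<open>k\<close> unless the
  coefficient is constant.\<close>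

lemma tau_D_quadratic:
  assumes u: "w \<in> U" "odd (deg w)" and v: "v \<in> V" and k: "deg v + 1 = k + deg w"
    and lower: "\<And>u. u \<in> U \<Longrightarrow> odd (deg u) \<Longrightarrow> deg u < k \<Longrightarrow> f (Inr u) \<in> J"
    and m: "m \<in> keys (D (gen (Inr v)))"
    and pure: "m \<in> over Q \<Longrightarrow> tau Q (Inr w) (D (mon m)) = 0"
    and I: "I = {u \<in> U. deg u = k}" and "odd k"
  shows "tau Q (Inr w) (D (mon m)) - (\<Sum>i\<in>I. if m = {#Inr i, Inr w#} then scl (mono_sign deg {#i#} {#w#}) (f (Inr i)) else 0) \<in> J"
    (is "?T - ?g \<in> J")
proof -
  have wQ: "Inr w \<notin> Q" using u by (auto simp: Q_def even_part_def)
  have mX: "m \<in> mons edeg XE" and mdeg: "mdeg edeg m = k + deg w"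
    using keys_D[of v m] v m k by auto
  have finI: "finite I" using I finite_U by simp
  show ?thesis
  proof (cases "m \<in> over Q")
    case True
    have "?g = 0" using True wQ by (intro sum.neutral) auto
    then show ?thesis using pure[OF True] poly_ideal_zero by simp
  next
    case False
    \<comment> \<open>The degree of \<open>m\<close> is even, so \<open>m\<close> has at least two odd generators as soon as it has one, and
      one of them is not \<open>w\<close>.\<close>
    have evc: "even (card (odds edeg m))" using mons_parity[OF mX] mdeg u \<open>odd k\<close> by simp
    obtain x where x: "x \<in># m" "x \<notin> Q" using False by (auto simp: over_def)
    have "x \<in> XE" using mX x by (auto simp: mons_def)
    then obtain i where "x = Inr i" "odd (deg i)" using not_Q x(2) by metis
    then have "x \<in> odds edeg m" using x(1) by (simp add: odds_def)
    then have c2: "card (odds edeg m) \<noteq> 0" "card (odds edeg m) \<noteq> 1" using evc by auto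
    have "\<exists>p\<in>odds edeg m. p \<noteq> Inr w"
    proof (rule ccontr)
      assume "\<not> ?thesis"
      then have "odds edeg m \<subseteq> {Inr w}" by auto
      from card_mono[OF _ this] have "card (odds edeg m) \<le> 1" by simp
      then show False using c2 by simp
    qed
    then obtain p where p: "p \<in> odds edeg m" "p \<noteq> Inr w" by blast
    then have "p \<in># m" "odd (edeg p)" by (auto simp: odds_def)
    then obtain m1 where m1: "m = add_mset p m1" using multi_member_split by metis
    have pQ: "p \<notin> Q" using Q_even \<open>odd (edeg p)\<close> by blast
    have "m1 \<notin> over Q"
    proof
      assume "m1 \<in> over Q"
      then have "odds edeg m = {p}" using \<open>odd (edeg p)\<close> by (simp add: m1 odds_add_mset E.odds_over)
      then show False using c2 by simp
    qed
    then have T: "?T = scl (mono_sign edeg {#p#} m1) (f p * tau Q (Inr w) (mon m1))"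
      unfolding m1 by (intro E.tau_D_odd[OF wQ]) (use mX m1 p pQ in auto)
    have "p \<in> XE" using mX m1 by (auto simp: mons_def)
    then obtain a where a: "p = Inr a" "a \<in> U \<union> V" "odd (deg a)" using not_Q pQ by blast
    have m_eq: "m = {#Inr i, Inr w#} \<longleftrightarrow> i = a \<and> m1 = {#Inr w#}" for i
      using p a m1 by (auto simp: add_eq_conv_ex add_mset_eq_single)
    show ?thesis
    proof (cases "Inr w \<in># m1 \<and> m1 - {#Inr w#} \<in> over Q")
      case False
      then have "m1 \<noteq> {#Inr w#}" by auto
      then have "?g = 0" by (intro sum.neutral) (simp add: m_eq)
      moreover have "?T = 0" unfolding T tau_mon using False by auto
      ultimately show ?thesis using poly_ideal_zero by simp
    next
      case True
      then obtain m2 where m2: "m1 = add_mset (Inr w) m2" "m2 \<in> over Q"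
        by (metis insert_DiffM)
      have T': "?T = scl (mono_sign edeg {#p#} m1) (mon m2 * f p)"
        unfolding T tau_mon using m2 by (simp add: mult.commute)
      have TJ: "?T \<in> J" if "f p \<in> J"
        unfolding T' by (intro poly_ideal_scl poly_ideal_mult that) (simp add: m2)
      have da: "deg a + mdeg edeg m2 = k" using mdeg a by (simp add: m1 m2)
      show ?thesis
      proof (cases "a \<in> V \<or> deg a < k")
        case True
        then have "f p \<in> J" using a lower by (auto intro: poly_ideal_base)
        moreover have "a \<notin> I" using True disjoint by (auto simp: I)
        then have "?g = 0" by (intro sum.neutral) (auto simp: m_eq)
        ultimately show ?thesis using TJ by simp
      next
        case False
        then have aU: "a \<in> U" "deg a = k" "mdeg edeg m2 = 0" using a da by auto
        have "m2 \<in> mons edeg XE" using E.over_mons[OF m2(2) Q_sub] .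
        then have "m2 = {#}" using aU mdeg_0_iff[of m2 edeg XE] XE_ge_2 by fastforce
        then have m1w: "m1 = {#Inr w#}" using m2 by simp
        then have "?g = (\<Sum>i\<in>I. if i = a then scl (mono_sign deg {#a#} {#w#}) (f p) else 0)"
          by (intro sum.cong) (auto simp: m_eq a)
        also have "\<dots> = scl (mono_sign deg {#a#} {#w#}) (f p)" using aU finI by (simp add: I)
        also have "\<dots> = ?T" unfolding T' by (simp add: \<open>m2 = {#}\<close> m1w a mono_sign_ext single_one)
        finally show ?thesis using poly_ideal_zero by simp
      qed
    qed
  qed
qed

text \<open>Summing the contributions of all monomials of \<open>D v\<close> gives the coefficient of \<open>w\<close> in
  \<open>D(D v) = 0\<close>.\<close>

lemma contraction_in_ideal:
  assumes w: "w \<in> U" "odd (deg w)" and v: "v \<in> V" and k: "deg v + 1 = k + deg w" "odd k"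
    and lower: "\<And>u. u \<in> U \<Longrightarrow> odd (deg u) \<Longrightarrow> deg u < k \<Longrightarrow> f (Inr u) \<in> J"
    and pure: "\<And>m. m \<in> keys (D (gen (Inr v))) \<Longrightarrow> m \<in> over Q \<Longrightarrow> tau Q (Inr w) (D (mon m)) = 0"
    and I: "I = {u \<in> U. deg u = k}"
  shows "(\<Sum>i\<in>I. scl (mono_sign deg {#i#} {#w#} * lookup (d (gen v)) {#i, w#}) (f (Inr i))) \<in> J"
proof -
  let ?z = "D (gen (Inr v))"
  let ?T = "\<lambda>m. tau Q (Inr w) (D (mon m))"
  let ?h = "\<lambda>m i. if m = {#Inr i, Inr w#} then scl (mono_sign deg {#i#} {#w#}) (f (Inr i)) else 0"
  let ?g = "\<lambda>m. \<Sum>i\<in>I. ?h m i"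
  have vL: "gen (Inr v) \<in> Lam edeg XE" using v by simp
  have mX: "mon m \<in> Lam edeg XE" if "m \<in> keys ?z" for m using keys_D(1)[of v m] v that by simp
  have "D ?z = (\<Sum>m\<in>keys ?z. scl (lookup ?z m) (D (mon m)))"
    by (subst sum_mon[of ?z], subst E.D_sum)
       (auto intro!: sum.cong E.D_scl mX ratvec.subspace_scale[OF subspace_Lam])
  then have 0: "(\<Sum>m\<in>keys ?z. scl (lookup ?z m) (?T m)) = 0"
    using E.D_D[OF vL] by (metis (no_types, lifting) sum.cong tau_scl tau_sum tau_zero)
  have "(\<Sum>m\<in>keys ?z. scl (lookup ?z m) (?T m - ?g m)) \<in> J"
    by (intro poly_ideal_sum poly_ideal_scl tau_D_quadratic[OF w v k(1) lower _ pure I k(2)])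
  then have "(\<Sum>m\<in>keys ?z. scl (lookup ?z m) (?T m)) - (\<Sum>m\<in>keys ?z. scl (lookup ?z m) (?g m)) \<in> J"
    by (simp only: ratvec.scale_right_diff_distrib sum_subtractf)
  then have "0 - (\<Sum>m\<in>keys ?z. scl (lookup ?z m) (?g m)) \<in> J" by (simp only: 0)
  then have "0 - (0 - (\<Sum>m\<in>keys ?z. scl (lookup ?z m) (?g m))) \<in> J"
    by (rule poly_ideal_diff[OF poly_ideal_zero])
  then have "(\<Sum>m\<in>keys ?z. scl (lookup ?z m) (?g m)) \<in> J" by simp
  also have "(\<Sum>m\<in>keys ?z. scl (lookup ?z m) (?g m)) = (\<Sum>i\<in>I. \<Sum>m\<in>keys ?z. scl (lookup ?z m) (?h m i))"
    by (simp only: ratvec.scale_sum_right) (rule sum.swap)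
  also have "\<dots> = (\<Sum>i\<in>I. scl (mono_sign deg {#i#} {#w#} * lookup (d (gen v)) {#i, w#}) (f (Inr i)))"
  proof (rule sum.cong[OF refl])
    fix i
    have "lookup ?z {#Inr i, Inr w#} = lookup (d (gen v)) {#i, w#}"
      using lookup_D_Inr[of v "{#i, w#}"] v by simp
    moreover have "(\<Sum>m\<in>keys ?z. scl (lookup ?z m) (?h m i)) =
      (\<Sum>m\<in>keys ?z. if m = {#Inr i, Inr w#} then scl (lookup ?z {#Inr i, Inr w#}) (scl (mono_sign deg {#i#} {#w#}) (f (Inr i))) else 0)"
      by (rule sum.cong) auto
    ultimately show "(\<Sum>m\<in>keys ?z. scl (lookup ?z m) (?h m i)) =
      scl (mono_sign deg {#i#} {#w#} * lookup (d (gen v)) {#i, w#}) (f (Inr i))"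
      by (auto simp: in_keys_iff mult.commute)
  qed
  finally show ?thesis .
qed

text \<open>The two alternatives of \<open>sep\<close> make the monomials of \<open>D v\<close> without odd generators harmless for
  different reasons. In the first, the coefficient of \<open>w\<close> in \<open>D q\<close> for \<open>q \<in> U\<close> even has degree at most
  0, so \<open>w\<close> could only be a linear term of \<open>D q\<close>. In the second, the degree of
  the \<open>D v\<close> that matter is at most that of every even generator of \<open>U\<close>, so such a generator could only be a linear
  term of \<open>D v\<close>. Linear terms do not occur.\<close>

lemma odd_values_in_ideal:
  assumes max: "displays_max deg U V d"
    and sep: "(\<forall>q\<in>even_part deg U. \<forall>u\<in>odd_part deg U. deg q < deg u) \<or>
      (\<forall>q\<in>even_part deg U. \<forall>u\<in>odd_part deg U. \<forall>w\<in>odd_part deg U. deg u + deg w \<le> deg q)"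
    and "u \<in> U" "odd (deg u)"
  shows "f (Inr u) \<in> J"
  using assms(3,4)
proof (induction "deg u" arbitrary: u rule: less_induct)
  case less
  show ?case
  proof (rule ccontr)
    assume notJ: "f (Inr u) \<notin> J"
    define k where "k = deg u"
    define I where "I = {u \<in> U. deg u = k}"
    have k: "odd k" using less.prems by (simp add: k_def)
    obtain l where l: "\<And>p q. l (p + q) = l p + l q" "\<And>c p. l (scl c p) = c * l p"
      "\<And>p. p \<in> J \<Longrightarrow> l p = 0" "l (f (Inr u)) = (1::rat)"
      using separating_functional[OF subspace_poly_ideal notJ] by metis
    have l0: "l 0 = 0" using l(1)[of 0 0] by simp
    have lsum: "l (\<Sum>i\<in>S. g i) = (\<Sum>i\<in>S. l (g i))" if "finite S" for S :: "'i set" and g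
      using that by (induction S rule: finite_induct) (simp_all add: l0 l(1))
    have finI: "finite I" using finite_U by (simp add: I_def)
    have "l (f (Inr u)) = 0"
    proof (rule maximal_imp_no_free_direction[OF max _ _ k, of I "\<lambda>i. l (f (Inr i))"])
      fix v w assume v: "v \<in> V" and w: "w \<in> U"
      let ?c = "\<lambda>i. mono_sign deg {#i#} {#w#} * lookup (d (gen v)) {#i, w#}"
      have "(\<Sum>i\<in>I. scl (?c i) (f (Inr i))) \<in> J"
      proof (cases "\<exists>i\<in>I. lookup (d (gen v)) {#i, w#} \<noteq> 0")
        case False
        then show ?thesis using poly_ideal_zero by simp
      next
        case True
        then obtain i where i: "i \<in> I" "{#i, w#} \<in> keys (d (gen v))" by (auto simp: in_keys_iff)
        have "homog deg (deg v + 1) (d (gen v))" using v by (intro D_homog) auto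
        with i have dv: "deg v + 1 = k + deg w" by (auto simp: homog_def I_def)
        then have wodd: "odd (deg w)" using V_odd[OF v] k by presburger
        show ?thesis
        proof (rule contraction_in_ideal[OF w wodd v dv k _ _ I_def])
          show "f (Inr u') \<in> J" if "u' \<in> U" "odd (deg u')" "deg u' < k" for u'
            using less.hyps that by (simp add: k_def)
          fix m assume m: "m \<in> keys (D (gen (Inr v)))" and mQ: "m \<in> over Q"
          have wQ: "Inr w \<notin> Q" using wodd by (auto simp: Q_def even_part_def)
          have wodd': "w \<in> odd_part deg U" and uodd': "u \<in> odd_part deg U"
            using w wodd less.prems by (simp_all add: odd_part_def)
          from sep show "tau Q (Inr w) (D (mon m)) = 0"
          proof
            assume sepA: "\<forall>q\<in>even_part deg U. \<forall>u\<in>odd_part deg U. deg q < deg u"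
            show ?thesis
            proof (rule E.tau_D_over[OF wQ subset_refl Q_sub _ mQ])
              fix q assume "q \<in> Q"
              then consider (a) j where "q = Inl j" "j < n" | (u) y where "q = Inr y" "y \<in> even_part deg U"
                by (auto simp: Q_def)
              then show "tau Q (Inr w) (D (gen q)) = 0"
              proof cases
                case a
                then show ?thesis by (simp add: D_Inl)
              next
                case u
                then have y: "y \<in> U \<union> V" by (simp add: even_part_def)
                have "\<not> (Inr w \<in># m \<and> m - {#Inr w#} \<in> over Q)" if m: "m \<in> keys (D (gen (Inr y)))" for m
                proof
                  assume "Inr w \<in># m \<and> m - {#Inr w#} \<in> over Q"
                  then obtain m2 where m2: "m = add_mset (Inr w) m2" "m2 \<in> over Q"
                    by (metis insert_DiffM)
                  have "deg y < deg w" using sepA u wodd' by blast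
                  moreover have "deg w + mdeg edeg m2 = deg y + 1" using keys_D(2)[OF y m] by (simp add: m2)
                  ultimately have "mdeg edeg m2 = 0" by linarith
                  moreover have "m2 \<in> mons edeg XE" using E.over_mons[OF m2(2) Q_sub] .
                  ultimately have "m2 = {#}" using mdeg_0_iff[of m2 edeg XE] XE_ge_2 by fastforce
                  then show False using keys_D(3)[OF y m] by (simp add: m2)
                qed
                then show ?thesis unfolding u by (intro tau_eq_zero) (auto simp: supp_def)
              qed
            qed
          next
            assume sepB: "\<forall>q\<in>even_part deg U. \<forall>u\<in>odd_part deg U. \<forall>w\<in>odd_part deg U. deg u + deg w \<le> deg q"
            have "m \<in> over A"
            proof (rule ccontr)
              assume "m \<notin> over A"
              then obtain x where x: "x \<in># m" "x \<notin> A" by (auto simp: over_def)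
              then have "x \<in> Q" using mQ by (auto simp: over_def)
              then obtain y where y: "Inr y \<in># m" "y \<in> even_part deg U" using x unfolding Q_def by blast
              then obtain m2 where m2: "m = add_mset (Inr y) m2" using multi_member_split by metis
              have "k + deg w \<le> deg y" using sepB y uodd' wodd' by (simp add: k_def)
              moreover have vv: "v \<in> U \<union> V" using v by simp
              moreover have "deg y + mdeg edeg m2 = deg v + 1" using keys_D(2)[OF vv m] by (simp add: m2)
              ultimately have "mdeg edeg m2 = 0" using dv by linarith
              moreover have "m2 \<in> mons edeg XE" using E.over_mons[OF _ Q_sub] mQ m2 by simp
              ultimately have "m2 = {#}" using mdeg_0_iff[of m2 edeg XE] XE_ge_2 by fastforce
              then show False using keys_D(3)[OF vv m] by (simp add: m2)
            qed
            then show ?thesis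
              by (intro E.tau_D_over[OF wQ _ Q_sub, of A]) (auto simp: Q_def D_Inl)
          qed
        qed
      qed
      then have "l (\<Sum>i\<in>I. scl (?c i) (f (Inr i))) = 0" by (rule l(3))
      then show "(\<Sum>i\<in>I. l (f (Inr i)) * mono_sign deg {#i#} {#w#} * lookup (d (gen v)) {#i, w#}) = 0"
        by (simp add: lsum[OF finI] l(2) mult_ac)
    qed (use less.prems in \<open>auto simp: I_def k_def\<close>)
    then show False using l(4) by simp
  qed
qed

lemma card_bound:
  assumes max: "displays_max deg U V d"
    and sep: "(\<forall>q\<in>even_part deg U. \<forall>u\<in>odd_part deg U. deg q < deg u) \<or>
      (\<forall>q\<in>even_part deg U. \<forall>u\<in>odd_part deg U. \<forall>w\<in>odd_part deg U. deg u + deg w \<le> deg q)"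
  shows "n + card (even_part deg U) \<le> card V"
proof -
  have J: "E.sigma (D p) \<in> J" if "p \<in> Lam edeg XE" for p
  proof (rule E.sigma_D_in_ideal[OF _ that])
    fix x assume x: "x \<in> XE"
    show "f x \<in> J"
    proof (cases "x \<in> Q")
      case True
      then show ?thesis using E.sigma_D_even[OF x] Q_even poly_ideal_zero by metis
    next
      case False
      then obtain i where i: "x = Inr i" "i \<in> U \<union> V" "odd (deg i)" using not_Q x by blast
      then show ?thesis using odd_values_in_ideal[OF max sep] by (auto intro: poly_ideal_base)
    qed
  qed
  obtain N1 where N1: "exact_from edeg XE D {} N1" using E.exact_from_finite[OF finite_D] ..
  obtain N2 where N2: "\<And>k u. N2 \<le> k \<Longrightarrow> u \<in> even_part deg U \<Longrightarrow> \<exists>\<Psi>\<in>Lam deg (U \<union> V).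
     homog deg (k * deg u - 1) \<Psi> \<and> mon (replicate_mset k u) = d \<Psi>"
    using even_power_exact by blast
  define N where "N = Suc (max N1 N2)"
  have N: "N1 \<le> N" "N2 \<le> N" "0 < N" by (auto simp: N_def)
  have sig: "E.sigma (mon (replicate_mset N q)) = mon (replicate_mset N q)" if "q \<in> Q" for q
    using that by (simp add: restr_mon over_def)
  \<comment> \<open>Powers of elements of \<open>A\<close> lie in \<open>J\<close>. For the other elements of \<open>Q\<close> a coboundary in the model is
    lifted to the extension, where the error \<open>r\<close> involves \<open>A\<close> in every term.\<close>
  have "card Q \<le> card V"
  proof (rule card_generators_le[where e = "\<lambda>v. deg v + 1" and f = "\<lambda>v. f (Inr v)" and deg = edeg and N = N])
    show "finite Q" using finite_U by (simp add: Q_def even_part_def)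
    show "f (Inr v) \<in> supp (over Q \<inter> {m. mdeg edeg m = deg v + 1})" if "v \<in> V" for v
    proof -
      have "homog edeg (deg v + 1) (D (gen (Inr v)))" using that by (intro E.D_homog) auto
      then show ?thesis by (simp add: homog_supp restr_supp flip: supp_Int)
    qed
    fix m assume m: "m \<in> over Q"
    show "\<exists>b\<in>supp (bounded Q N). mon m - b \<in> J"
    proof (rule congruent_bounded[where A = A and deg = edeg])
      fix a assume a: "a \<in> A"
      then have aQ: "a \<in> Q" by (simp add: Q_def)
      have mX: "replicate_mset N a \<in> mons edeg XE"
        by (rule E.over_mons[OF _ Q_sub]) (use aQ in \<open>auto simp: over_def\<close>)
      have DA: "D (gen i) \<in> {0}" if "i \<in> A" for i using that by (auto simp: D_Inl)
      have AX: "A \<subseteq> XE" using Q_sub by (simp add: Q_def)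
      have "D p \<in> {0}" if "p \<in> Lam edeg A" for p
        by (rule E.D_in_ideal[OF AX ratvec.subspace_single_0 DA _ _ that]) auto
      moreover have "mon (replicate_mset N a) \<in> Lam edeg A" using a by (auto simp: mons_def)
      ultimately have "D (mon (replicate_mset N a)) = 0" by blast
      moreover have "N1 \<le> mdeg edeg (replicate_mset N a)" using a N by auto
      ultimately obtain \<Psi> where \<Psi>: "\<Psi> \<in> Lam edeg XE" "mon (replicate_mset N a) - D \<Psi> \<in> supp (meets {})"
        using N1 mX unfolding exact_from_def by (metis homog_mon mon_in_Lam zero_in_supp)
      then have "mon (replicate_mset N a) = D \<Psi>" by (simp add: supp_def)
      then show "mon (replicate_mset N a) \<in> J" using J[OF \<Psi>(1)] sig[OF aQ] by metis
    next
      fix q assume q: "q \<in> Q - A"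
      then obtain y where y: "q = Inr y" "y \<in> even_part deg U" by (auto simp: Q_def)
      obtain \<Psi> where \<Psi>: "\<Psi> \<in> Lam deg (U \<union> V)" "homog deg (N * deg y - 1) \<Psi>" "mon (replicate_mset N y) = d \<Psi>"
        using N2[OF N(2) y(2)] by blast
      have L: "emb \<Psi> \<in> Lam edeg XE"
        using \<Psi>(1) unfolding Lam_supp by (rule emb_in_supp) (rule image_Inr_mons)
      have "homog edeg (N * deg y - 1) (emb \<Psi>)"
        using \<Psi>(2) unfolding homog_supp by (rule emb_in_supp) (simp add: mdeg_ext)
      then have h: "homog edeg (N * deg y - 1 + 1) (D (emb \<Psi>))" by (rule E.D_homog[OF L])
      have "2 \<le> deg y" using y deg_ge_2[of y] by (simp add: even_part_def)
      then have Npos: "N * deg y - 1 + 1 = N * deg y" using N by simp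
      define r where "r = mon (replicate_mset N q) - D (emb \<Psi>)"
      have "ext_proj r = 0"
      proof -
        have "ext_proj (mon (replicate_mset N q)) = mon (replicate_mset N y)"
          using ext_proj_mon[of "replicate_mset N y"] y by simp
        then show ?thesis using proj_D[OF L] \<Psi>(3) by (simp add: r_def ext_proj_diff ext_proj_emb)
      qed
      have "E.sigma r \<in> supp (over Q \<inter> meets A \<inter> {m. mdeg edeg m = N * edeg q})"
      proof -
        have "mon (replicate_mset N q) \<in> supp {m. mdeg edeg m = N * edeg q}" by simp
        then have "r \<in> supp {m. mdeg edeg m = N * edeg q}"
          unfolding r_def using h y Npos by (intro supp_diff) (auto simp: homog_supp)
        moreover have "E.sigma r \<in> supp (meets A)"
          unfolding supp_iff
        proof (intro allI impI)
          fix m assume nA: "m \<notin> meets A"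
          show "lookup (E.sigma r) m = 0"
          proof (cases "m \<in> over Q")
            case True
            then have "m = image_mset Inr (image_mset projr m)"
              using nA by (intro no_Inl_imp_image) (unfold over_def meets_def Q_def, blast)
            then have "lookup r m = lookup (ext_proj r) (image_mset projr m)"
              by (metis lookup_ext_proj)
            then show ?thesis using \<open>ext_proj r = 0\<close> by (simp add: lookup_restr)
          qed (simp add: lookup_restr)
        qed
        ultimately show ?thesis by (simp add: restr_supp flip: supp_Int)
      qed
      moreover have "mon (replicate_mset N q) - E.sigma r = E.sigma (D (emb \<Psi>))"
        using q sig[of q] by (simp add: r_def restr_diff)
      ultimately show "\<exists>r\<in>supp (over Q \<inter> meets A \<inter> {m. mdeg edeg m = N * edeg q}). mon (replicate_mset N q) - r \<in> J"
        using J[OF L] by metis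
    next
      show "0 < edeg q" if "q \<in> Q" for q using that XE_ge_2[of q] Q_sub by force
    qed (use m N in \<open>auto simp: Q_def\<close>)
  qed (use finite_V in auto)
  moreover have "card Q = n + card (even_part deg U)"
    using finite_U unfolding Q_def
    by (subst card_Un_disjoint) (auto simp: card_image even_part_def inj_on_def)
  ultimately show ?thesis by simp
qed

end

section \<open>The degree hypotheses and the toral rank\<close>

lemma n_connected_gens: "n_connected c deg X \<Longrightarrow> x \<in> X \<Longrightarrow> c < int (deg x)"
proof (rule ccontr)
  assume c: "n_connected c deg X" and x: "x \<in> X" and "\<not> c < int (deg x)"
  then have "{z \<in> lin X. homog deg (deg x) z} = {0}" by (auto simp: n_connected_def)
  moreover have "gen x \<in> {z \<in> lin X. homog deg (deg x) z}" using lin_gen[OF x] by simp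
  ultimately have "gen x = 0" by blast
  then show False by (metis gen_mon lookup_single_eq lookup_zero zero_neq_one)
qed

lemma n_co_connected_gens: "n_co_connected c deg X \<Longrightarrow> x \<in> X \<Longrightarrow> int (deg x) < c"
proof (rule ccontr)
  assume c: "n_co_connected c deg X" and x: "x \<in> X" and "\<not> int (deg x) < c"
  then have "{z \<in> lin X. homog deg (deg x) z} = {0}" by (auto simp: n_co_connected_def)
  moreover have "gen x \<in> {z \<in> lin X. homog deg (deg x) z}" using lin_gen[OF x] by simp
  ultimately have "gen x = 0" by blast
  then show False by (metis gen_mon lookup_single_eq lookup_zero zero_neq_one)
qed

text \<open>The parities sharpen the bounds by one: in the first case the odd degrees are at least
  \<open>2r + 1\<close> and the even ones at most \<open>2r\<close>; in the second the odd degrees are at most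
  \<open>2s - 1\<close> and the even ones at least \<open>4s - 2\<close>.\<close>

lemma degree_separation:
  assumes "(\<exists>r::int. n_connected (2 * r - 1) deg (odd_part deg U) \<and>
                   n_co_connected (2 * r + 2) deg (even_part deg U)) \<or>
         (\<exists>s::int. n_co_connected (2 * s + 1) deg (odd_part deg U) \<and>
                   n_connected (4 * s - 4) deg (even_part deg U))"
  shows "(\<forall>q\<in>even_part deg U. \<forall>u\<in>odd_part deg U. deg q < deg u) \<or>
      (\<forall>q\<in>even_part deg U. \<forall>u\<in>odd_part deg U. \<forall>w\<in>odd_part deg U. deg u + deg w \<le> deg q)"
  using assms
proof
  assume "\<exists>r::int. n_connected (2 * r - 1) deg (odd_part deg U) \<and>
                   n_co_connected (2 * r + 2) deg (even_part deg U)"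
  then obtain r :: int where r: "n_connected (2 * r - 1) deg (odd_part deg U)"
    "n_co_connected (2 * r + 2) deg (even_part deg U)" by blast
  have "deg q < deg u" if q: "q \<in> even_part deg U" and u: "u \<in> odd_part deg U" for q u
  proof -
    have "2 * r - 1 < int (deg u)" "int (deg q) < 2 * r + 2" "odd (deg u)" "even (deg q)"
      using n_connected_gens[OF r(1) u] n_co_connected_gens[OF r(2) q] q u
      by (auto simp: even_part_def odd_part_def)
    then show ?thesis by presburger
  qed
  then show ?thesis by blast
next
  assume "\<exists>s::int. n_co_connected (2 * s + 1) deg (odd_part deg U) \<and>
                   n_connected (4 * s - 4) deg (even_part deg U)"
  then obtain s :: int where s: "n_co_connected (2 * s + 1) deg (odd_part deg U)"
    "n_connected (4 * s - 4) deg (even_part deg U)" by blast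
  have "deg u + deg w \<le> deg q" if q: "q \<in> even_part deg U" and u: "u \<in> odd_part deg U" and w: "w \<in> odd_part deg U" for q u w
  proof -
    have "4 * s - 4 < int (deg q)" "int (deg u) < 2 * s + 1" "int (deg w) < 2 * s + 1"
       "odd (deg u)" "odd (deg w)" "even (deg q)"
      using n_connected_gens[OF s(2) q] n_co_connected_gens[OF s(1) u] n_co_connected_gens[OF s(1) w] q u w
      by (auto simp: even_part_def odd_part_def)
    then show ?thesis by presburger
  qed
  then show ?thesis by blast
qed

theorem theorem2p9:
  fixes deg :: "'i::linorder \<Rightarrow> nat" and U V :: "'i set" and d :: "'i galg \<Rightarrow> 'i galg"
  assumes "two_stage deg U V d"
    and "elliptic deg (U \<union> V) d"
    and "\<forall>v \<in> lin V. d v \<in> Lam_len deg 2 U"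
    and "displays_max deg U V d"
    and "(\<exists>r::int. n_connected (2 * r - 1) deg (odd_part deg U) \<and>
                   n_co_connected (2 * r + 2) deg (even_part deg U)) \<or>
         (\<exists>s::int. n_co_connected (2 * s + 1) deg (odd_part deg U) \<and>
                   n_connected (4 * s - 4) deg (even_part deg U))"
  shows "ereal_of_enat (toral_rank deg (U \<union> V) d)
           \<le> ereal (real (ratvec.dim (lin V)) - real (ratvec.dim (lin (even_part deg U))))"
proof -
  interpret M: quad_model deg U V d by (rule quad_modelI[OF assms(1-3)])
  have bound: "n + card (even_part deg U) \<le> card V"
    if "KS_extension deg (U \<union> V) d n D" "finite_dim_cohomology (ext_deg deg) (ext_gens n (U \<union> V)) D" for n D
  proof -
    interpret toral_extension deg U V d n D by standard (rule that)+
    show ?thesis by (rule card_bound[OF assms(4) degree_separation[OF assms(5)]])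
  qed
  have "toral_rank deg (U \<union> V) d \<le> enat (card V - card (even_part deg U))"
    unfolding toral_rank_def
  proof (rule Sup_least)
    fix x assume "x \<in> {enat n |n. \<exists>D. KS_extension deg (U \<union> V) d n D \<and>
       finite_dim_cohomology (ext_deg deg) (ext_gens n (U \<union> V)) D}"
    then obtain n D where "x = enat n" "n + card (even_part deg U) \<le> card V" using bound by blast
    then show "x \<le> enat (card V - card (even_part deg U))" by simp
  qed
  then have "ereal_of_enat (toral_rank deg (U \<union> V) d) \<le> ereal_of_enat (enat (card V - card (even_part deg U)))"
    by (simp only: ereal_of_enat_le_iff)
  then show ?thesis using M.card_even_le by (simp add: dim_lin of_nat_diff)
qed

end
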